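(* Let $p=(x^{(C)},y^{(p)})\in\mathcal{M}_s(\mathcal{G})$ and let $c>0$. There exists a neighborhood $U(p)$ of $p$ such that for every sequence $\{z_k\}=\{(x_k,y_k)\}$ generated by the FDFW applied to the maximization of $h_{\mathcal{G}}$ over $\mathcal{P}_s$, with stepsizes satisfying $$\alpha_k\ge\bar\alpha_k:=\min\Big(\alpha_k^{\max},\,c\,\frac{\nabla h_{\mathcal{G}}(z_k)^{\intercal}d_k}{\|d_k\|^2}\Big)\quad\text{for all }k,\qquad\text{(S1)}$$ if $\bar k:=\min\{k\in\mathbb{N}_0 : z_k\in U(p)\}$ (assuming the sequence enters $U(p)$), then: (a) if $h_{\mathcal{G}}(z_k)$ is monotonically increasing in $k$, then $\mathrm{supp}(x_k)=C$ and $y_k=y^{(p)}$ for every $k\ge\bar k+\dim\mathcal{F}(z_{\bar k})$; (b) if in addition, for some constant $\rho>0$, $$h_{\mathcal{G}}(z_k+\alpha_kd_k)-h_{\mathcal{G}}(z_k)\ge\rho\,\bar\alpha_k\,\nabla h_{\mathcal{G}}(z_k)^{\intercal}d_k\quad\text{for all }k,\qquad\text{(S2)}$$ then $z_k\to p$.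
   Context: $\mathcal{G}=(V,E)$ is a finite simple undirected graph, $n=|V|$, $V$ identified with $\{1,\dots,n\}$, $A_{\mathcal{G}}$ its adjacency matrix, $\bar{\mathcal{G}}=(V,\bar E)$ the complementary graph; $e$ is the all-ones vector; $s\in\mathbb{N}$, $s\le|\bar E|$. $D_s(\mathcal{G})=\{y\in\{0,1\}^{\bar E}:e^{\intercal}y\le s\}$, $D'_s(\mathcal{G})=\{y\in[0,1]^{\bar E}:e^{\intercal}y\le s\}$. For $y\in D'_s(\mathcal{G})$, $A(y)\in\mathbb{R}^{n\times n}$ is the symmetric matrix with $A(y)_{ij}=y_{ij}$ if $\{i,j\}\in\bar E$ and $0$ otherwise; for $y\in D_s(\mathcal{G})$, $\mathcal{G}(y)$ is the graph with adjacency matrix $A_{\mathcal{G}}+A(y)$. $\mathcal{P}_s=\Delta_{n-1}\times D'_s(\mathcal{G})$ with $\Delta_{n-1}$ the standard simplex in $\mathbb{R}^n$. For fixed $\alpha\in(0,2)$, $\beta>0$, $$h_{\mathcal{G}}(x,y)=x^{\intercal}[A_{\mathcal{G}}+A(y)]x+\tfrac{\alpha}{2}\|x\|^2+\tfrac{\beta}{2}\|y\|^2 .$$ $\mathcal{M}_s(\mathcal{G})$ is the set of strict local maximizers of $h_{\mathcal{G}}$ on $\mathcal{P}_s$. For nonempty $C\subseteq V$, $x^{(C)}=\frac{1}{|C|}\sum_{i\in C}e_i$. Every $p\in\mathcal{M}_s(\mathcal{G})$ is of the form $p=(x^{(C)},y^{(p)})$ with $y^{(p)}\in D_s(\mathcal{G})$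 and $C$ a maximal clique of $\mathcal{G}(y^{(p)})$ (which is an $s$-defective clique of $\mathcal{G}$); this is the notation used. FDFW (Frank-Wolfe method with in face directions) for maximizing a smooth (continuously differentiable) $f$ over a polytope $\mathcal{Q}$ (here $f=h_{\mathcal{G}}$, $\mathcal{Q}=\mathcal{P}_s$, iterates denoted $z_k$): for $w\in\mathcal{Q}$ let $\mathcal{F}(w)$ be the minimal face of $\mathcal{Q}$ containing $w$; $w$ is stationary if $\nabla f(w)^{\intercal}(v-w)\le0$ for all $v\in\mathcal{Q}$. Start with $w_0\in\mathcal{Q}$. At iteration $k$: stop if $w_k$ is stationary; otherwise choose $s_k\in\arg\max_{y\in\mathcal{Q}}\nabla f(w_k)^{\intercal}y$, $d_k^{\mathcal{FW}}=s_k-w_k$, and $v_k\in\arg\min_{y\in\mathcal{F}(w_k)}\nabla f(w_k)^{\intercal}y$, $d_k^{\mathcal{FD}}=w_k-v_k$. Set $d_k=d_k^{\mathcal{FW}}$ if $\nabla f(w_k)^{\intercal}d_k^{\mathcal{FW}}\ge\nabla f(w_k)^{\intercal}d_k^{\mathcal{FD}}$, and $d_k=d_k^{\mathcal{FD}}$ otherwise. Choose a stepsize $\alpha_k\in(0,\alpha_k^{\max}]$, where $\alpha_k^{\max}$ is the maximal feasible stepsize $\max\{t\ge0:w_k+td_k\in\mathcal{Q}\}$, and set $w_{k+1}=w_k+\alpha_kd_k$. If the method stops at iteration $k$, the sequence is continued as constant, $w_j=w_k$ for $j\ge k$ (stepsize conditions are then required only before stopping). "Monotonically increasing" is meant in the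 non-strict sense. *)

theory Defs
  imports "HOL-Analysis.Analysis"
begin

section \<open>The regularized \<open>s\<close>-defective clique problem\<close>

text \<open>
  A simple graph has vertex set \<open>UNIV :: 'n set\<close> for a finite type \<open>'n\<close> and is given by its
  set of edges, which are two-element sets of vertices.
\<close>

definition all_pairs :: "'n::finite set set" where
  "all_pairs = {e. card e = 2}"

definition simple_graph :: "'n::finite set set \<Rightarrow> bool" where
  "simple_graph E \<longleftrightarrow> E \<subseteq> all_pairs"

definition co_edges :: "'n::finite set set \<Rightarrow> 'n set set" where
  "co_edges E = all_pairs - E"

definition adj_matrix :: "'n::finite set set \<Rightarrow> real ^ 'n ^ 'n" where
  "adj_matrix E = (\<chi> i j. if {i, j} \<in> E then 1 else 0)"

text \<open>
  The index set of the vectors \<open>y\<close> is the set of non-edges, which depends on the graph and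
  hence is not a type. Such vectors are represented in \<open>real ^ ('n set)\<close> with all coordinates
  outside \<open>co_edges E\<close> equal to \<open>0\<close>. This is an isometric copy of the coordinate space over
  \<open>co_edges E\<close>: norms, inner products, faces and affine dimensions are the same. Gradients only
  occur in inner products with vectors of this subspace.
\<close>

definition co_matrix :: "'n::finite set set \<Rightarrow> real ^ ('n set) \<Rightarrow> real ^ 'n ^ 'n" where
  "co_matrix E y = (\<chi> i j. if {i, j} \<in> co_edges E then y $ {i, j} else 0)"

definition D'_set :: "'n::finite set set \<Rightarrow> nat \<Rightarrow> (real ^ ('n set)) set" where
  "D'_set E s = {y. (\<forall>e. e \<notin> co_edges E \<longrightarrow> y $ e = 0)
      \<and> (\<forall>e\<in>co_edges E. 0 \<le> y $ e \<and> y $ e \<le> 1)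
      \<and> (\<Sum>e\<in>co_edges E. y $ e) \<le> real s}"

definition std_simplex :: "(real ^ 'n::finite) set" where
  "std_simplex = {x. (\<forall>i. 0 \<le> x $ i) \<and> (\<Sum>i\<in>UNIV. x $ i) = 1}"

definition P_set :: "'n::finite set set \<Rightarrow> nat \<Rightarrow> ((real ^ 'n) \<times> (real ^ ('n set))) set" where
  "P_set E s = std_simplex \<times> D'_set E s"

definition h_obj ::
  "'n::finite set set \<Rightarrow> real \<Rightarrow> real \<Rightarrow> (real ^ 'n) \<times> (real ^ ('n set)) \<Rightarrow> real" where
  "h_obj E \<alpha> \<beta> = (\<lambda>(x, y). x \<bullet> ((adj_matrix E + co_matrix E y) *v x)
      + \<alpha> / 2 * (norm x)\<^sup>2 + \<beta> / 2 * (norm y)\<^sup>2)"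

definition strict_local_maximizers :: "('a::topological_space \<Rightarrow> real) \<Rightarrow> 'a set \<Rightarrow> 'a set" where
  "strict_local_maximizers f S =
     {p \<in> S. \<exists>W. open W \<and> p \<in> W \<and> (\<forall>q \<in> S \<inter> W. q \<noteq> p \<longrightarrow> f q < f p)}"

definition M_set ::
  "'n::finite set set \<Rightarrow> nat \<Rightarrow> real \<Rightarrow> real \<Rightarrow> ((real ^ 'n) \<times> (real ^ ('n set))) set" where
  "M_set E s \<alpha> \<beta> = strict_local_maximizers (h_obj E \<alpha> \<beta>) (P_set E s)"

definition char_vec :: "'n::finite set \<Rightarrow> real ^ 'n" where
  "char_vec C = (1 / real (card C)) *\<^sub>R (\<Sum>i\<in>C. axis i 1)"

definition vec_supp :: "real ^ 'n::finite \<Rightarrow> 'n set" where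
  "vec_supp x = {i. x $ i \<noteq> 0}"

section \<open>The Frank-Wolfe method with in face directions, for maximization\<close>

definition gradient :: "('a::euclidean_space \<Rightarrow> real) \<Rightarrow> 'a \<Rightarrow> 'a" where
  "gradient f w = (THE D. GDERIV f w :> D)"

definition minimal_face :: "'a::euclidean_space set \<Rightarrow> 'a \<Rightarrow> 'a set" where
  "minimal_face Q w = \<Inter>{F. F face_of Q \<and> w \<in> F}"

definition stationary :: "('a::euclidean_space \<Rightarrow> real) \<Rightarrow> 'a set \<Rightarrow> 'a \<Rightarrow> bool" where
  "stationary f Q w \<longleftrightarrow> (\<forall>v\<in>Q. gradient f w \<bullet> (v - w) \<le> 0)"

definition fdfw_direction :: "('a::euclidean_space \<Rightarrow> real) \<Rightarrow> 'a set \<Rightarrow> 'a \<Rightarrow> 'a \<Rightarrow> bool" where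
  "fdfw_direction f Q w d \<longleftrightarrow>
     (\<exists>u v. is_arg_max (\<lambda>y. gradient f w \<bullet> y) (\<lambda>y. y \<in> Q) u
          \<and> is_arg_min (\<lambda>y. gradient f w \<bullet> y) (\<lambda>y. y \<in> minimal_face Q w) v
          \<and> d = (if gradient f w \<bullet> (u - w) \<ge> gradient f w \<bullet> (w - v) then u - w else w - v))"

text \<open>For compact \<open>Q\<close>, \<open>w \<in> Q\<close> and \<open>d \<noteq> 0\<close> the maximum below exists.\<close>

definition max_step :: "'a::euclidean_space set \<Rightarrow> 'a \<Rightarrow> 'a \<Rightarrow> real" where
  "max_step Q w d = (GREATEST t. 0 \<le> t \<and> w + t *\<^sub>R d \<in> Q)"

text \<open>
  Iterates \<open>w\<close>, directions \<open>d\<close> and stepsizes \<open>a\<close>. Once a stationary point is reached the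
  sequence is constant, and \<open>d k\<close>, \<open>a k\<close> are arbitrary and irrelevant from then on.
\<close>

definition fdfw_sequence ::
  "('a::euclidean_space \<Rightarrow> real) \<Rightarrow> 'a set \<Rightarrow> (nat \<Rightarrow> 'a) \<Rightarrow> (nat \<Rightarrow> 'a) \<Rightarrow> (nat \<Rightarrow> real) \<Rightarrow> bool" where
  "fdfw_sequence f Q w d a \<longleftrightarrow> w 0 \<in> Q \<and>
     (\<forall>k. if stationary f Q (w k) then w (Suc k) = w k
          else fdfw_direction f Q (w k) (d k)
             \<and> 0 < a k \<and> a k \<le> max_step Q (w k) (d k)
             \<and> w (Suc k) = w k + a k *\<^sub>R d k)"

definition step_bound ::
  "('a::euclidean_space \<Rightarrow> real) \<Rightarrow> 'a set \<Rightarrow> real \<Rightarrow> 'a \<Rightarrow> 'a \<Rightarrow> real" where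
  "step_bound f Q c w d = min (max_step Q w d) (c * ((gradient f w \<bullet> d) / (norm d)\<^sup>2))"

definition stepsize_S1 ::
  "('a::euclidean_space \<Rightarrow> real) \<Rightarrow> 'a set \<Rightarrow> real \<Rightarrow> (nat \<Rightarrow> 'a) \<Rightarrow> (nat \<Rightarrow> 'a) \<Rightarrow> (nat \<Rightarrow> real) \<Rightarrow> bool" where
  "stepsize_S1 f Q c w d a \<longleftrightarrow>
     (\<forall>k. \<not> stationary f Q (w k) \<longrightarrow> a k \<ge> step_bound f Q c (w k) (d k))"

definition stepsize_S2 ::
  "('a::euclidean_space \<Rightarrow> real) \<Rightarrow> 'a set \<Rightarrow> real \<Rightarrow> real \<Rightarrow> (nat \<Rightarrow> 'a) \<Rightarrow> (nat \<Rightarrow> 'a) \<Rightarrow> (nat \<Rightarrow> real) \<Rightarrow> bool" where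
  "stepsize_S2 f Q c \<rho> w d a \<longleftrightarrow>
     (\<forall>k. \<not> stationary f Q (w k) \<longrightarrow>
        f (w k + a k *\<^sub>R d k) - f (w k) \<ge> \<rho> * step_bound f Q c (w k) (d k) * (gradient f (w k) \<bullet> d k))"

end

theory Submission
  imports Defs
begin

text \<open>
  Strictness of the local maximum forces \<open>yp\<close> to be binary with coordinate sum \<open>s\<close> and \<open>C\<close> to be a
  maximal clique: a fractional \<open>y\<close> or a missing edge inside \<open>C\<close> gives a feasible line through \<open>p\<close>
  along which the objective is convex. Hence strict complementarity holds, that is, the face exposed
  by the gradient at \<open>p\<close> is \<open>F = {x \<in> \<Delta>. supp x \<subseteq> C} \<times> {yp}\<close> and \<open>p\<close> lies in its relative interior.

  Near \<open>p\<close> but off \<open>F\<close>, some vertex of the minimal face lies off \<open>F\<close>, so the in-face gain is bounded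
  below while the Frank-Wolfe gain is tiny. The method therefore takes a maximal in-face step, which
  is short and lowers the dimension of the minimal face. Once on \<open>F\<close>, the method stays there, and since
  \<open>h = h(p) - (1 - \<alpha>/2) \<parallel>\<cdot> - p\<parallel>\<^sup>2\<close> on \<open>F\<close>, monotonicity keeps the iterates close to \<open>p\<close>. If they
  stayed away from \<open>p\<close>, the sufficient increase condition would make \<open>h\<close> unbounded.
\<close>

section \<open>Minimal faces and maximal stepsizes\<close>

lemma minimal_face_face_of:
  assumes "convex Q" "w \<in> Q"
  shows "minimal_face Q w face_of Q"
  unfolding minimal_face_def
  using assms by (intro face_of_Inter) (auto intro: face_of_refl)

lemma mem_minimal_face: "w \<in> minimal_face Q w"
  by (auto simp: minimal_face_def)

lemma minimal_face_subset: "F face_of Q \<Longrightarrow> w \<in> F \<Longrightarrow> minimal_face Q w \<subseteq> F"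
  by (auto simp: minimal_face_def)

text \<open>Otherwise a supporting hyperplane at \<open>w\<close> cuts out of the minimal face a
  face containing \<open>w\<close>. By minimality this is the whole minimal face, although its
  relative interior lies strictly on one side.\<close>

lemma minimal_face_rel_interior:
  fixes Q :: "'a::euclidean_space set"
  assumes "convex Q" "w \<in> Q"
  shows "w \<in> rel_interior (minimal_face Q w)"
proof (rule ccontr)
  let ?M = "minimal_face Q w"
  assume notin: "w \<notin> rel_interior ?M"
  have face: "?M face_of Q" using minimal_face_face_of assms .
  then have "convex ?M" by (rule face_of_imp_convex)
  obtain a where a: "\<And>y. y \<in> ?M \<Longrightarrow> a \<bullet> w \<le> a \<bullet> y"
      "\<And>y. y \<in> rel_interior ?M \<Longrightarrow> a \<bullet> w < a \<bullet> y"
    using supporting_hyperplane_rel_boundary[OF \<open>convex ?M\<close> mem_minimal_face notin] by metis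
  have "?M \<inter> {x. a \<bullet> x = a \<bullet> w} face_of ?M"
    using \<open>convex ?M\<close> a(1) by (rule face_of_Int_supporting_hyperplane_ge)
  then have "?M \<inter> {x. a \<bullet> x = a \<bullet> w} face_of Q" using face by (rule face_of_trans)
  then have "?M \<subseteq> {x. a \<bullet> x = a \<bullet> w}"
    using minimal_face_subset[of "?M \<inter> {x. a \<bullet> x = a \<bullet> w}" Q w] mem_minimal_face[of w Q] by auto
  moreover obtain y where "y \<in> rel_interior ?M"
    using rel_interior_eq_empty[OF \<open>convex ?M\<close>] mem_minimal_face[of w Q] by auto
  ultimately show False
    using a(2)[of y] rel_interior_subset by fastforce
qed

text \<open>The feasible stepsizes form a nonempty compact set, so \<open>GREATEST\<close> is an
  attained maximum. Boundedness comes from \<open>d \<noteq> 0\<close> and the boundedness of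
  \<open>Q\<close>.\<close>

lemma
  fixes Q :: "'a::euclidean_space set"
  assumes "compact Q" "w \<in> Q" "d \<noteq> 0"
  shows max_step_nonneg: "0 \<le> max_step Q w d"
    and max_step_mem: "w + max_step Q w d *\<^sub>R d \<in> Q"
    and le_max_step: "\<And>t. 0 \<le> t \<Longrightarrow> w + t *\<^sub>R d \<in> Q \<Longrightarrow> t \<le> max_step Q w d"
proof -
  let ?T = "{t. 0 \<le> t \<and> w + t *\<^sub>R d \<in> Q}"
  obtain B where B: "\<And>u. u \<in> Q \<Longrightarrow> norm u \<le> B"
    using \<open>compact Q\<close> compact_imp_bounded bounded_iff by metis
  have "?T = {0..} \<inter> (\<lambda>t. w + t *\<^sub>R d) -` Q" by auto
  moreover have "closed ((\<lambda>t. w + t *\<^sub>R d) -` Q)"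
    by (intro closed_vimage compact_imp_closed \<open>compact Q\<close> continuous_intros)
  ultimately have "closed ?T" by (metis closed_Int closed_atLeast)
  moreover have "norm t \<le> (B + B) / norm d" if "t \<in> ?T" for t
  proof -
    have "t *\<^sub>R d = (w + t *\<^sub>R d) - w" by simp
    then have "norm (t *\<^sub>R d) \<le> B + B"
      using norm_triangle_ineq4[of "w + t *\<^sub>R d" w] B[of w] B[of "w + t *\<^sub>R d"] that assms(2) by auto
    then show ?thesis using \<open>d \<noteq> 0\<close> by (simp add: field_simps)
  qed
  ultimately have "compact ?T"
    unfolding compact_eq_bounded_closed bounded_iff by blast
  moreover have "0 \<in> ?T" using assms by simp
  ultimately obtain t0 where t0: "t0 \<in> ?T" "\<And>t. t \<in> ?T \<Longrightarrow> t \<le> t0"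
    using compact_attains_sup[of ?T] by blast
  have eq: "max_step Q w d = t0"
    unfolding max_step_def using t0 by (intro Greatest_equality) auto
  show "0 \<le> max_step Q w d" "w + max_step Q w d *\<^sub>R d \<in> Q"
    and "\<And>t. 0 \<le> t \<Longrightarrow> w + t *\<^sub>R d \<in> Q \<Longrightarrow> t \<le> max_step Q w d"
    using t0 by (auto simp: eq)
qed

lemma step_mem:
  fixes Q :: "'a::euclidean_space set"
  assumes "compact Q" "convex Q" "w \<in> Q" "d \<noteq> 0" "0 < a" "a \<le> max_step Q w d"
  shows "w + a *\<^sub>R d \<in> Q"
proof -
  let ?m = "max_step Q w d"
  have "(1 - a / ?m) *\<^sub>R w + (a / ?m) *\<^sub>R (w + ?m *\<^sub>R d) \<in> Q"
    using assms max_step_mem[OF assms(1,3,4)] by (intro convexD_alt) auto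
  also have "(1 - a / ?m) *\<^sub>R w + (a / ?m) *\<^sub>R (w + ?m *\<^sub>R d) = w + a *\<^sub>R d"
    using assms by (simp add: algebra_simps)
  finally show ?thesis .
qed

section \<open>Directions and iterates of the method\<close>

lemma gradient_eq:
  assumes "GDERIV f w :> D"
  shows "gradient f w = D"
  unfolding gradient_def
proof (rule the_equality[where P = "\<lambda>D. GDERIV f w :> D", OF assms])
  fix D' assume "GDERIV f w :> D'"
  then have "(\<lambda>h. h \<bullet> D') = (\<lambda>h. h \<bullet> D)"
    using assms has_derivative_unique unfolding gderiv_def by blast
  then show "D' = D" by (metis vector_eq_ldot)
qed

text \<open>The interface to the choice of direction: its slope dominates that of both candidates,
  and it is one of them.\<close>

lemma
  assumes "fdfw_direction f Q w d"
  shows fdfw_direction_ge_FW: "v \<in> Q \<Longrightarrow> gradient f w \<bullet> (v - w) \<le> gradient f w \<bullet> d"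
    and fdfw_direction_ge_FD: "v \<in> minimal_face Q w \<Longrightarrow> gradient f w \<bullet> (w - v) \<le> gradient f w \<bullet> d"
    and fdfw_direction_cases:
      "(\<exists>u\<in>Q. d = u - w \<and> (\<forall>v\<in>Q. gradient f w \<bullet> v \<le> gradient f w \<bullet> u))
       \<or> (\<exists>v\<in>minimal_face Q w. d = w - v)"
proof -
  let ?g = "gradient f w"
  obtain u v where u: "u \<in> Q" "\<And>y. y \<in> Q \<Longrightarrow> ?g \<bullet> y \<le> ?g \<bullet> u"
    and v: "v \<in> minimal_face Q w" "\<And>y. y \<in> minimal_face Q w \<Longrightarrow> ?g \<bullet> v \<le> ?g \<bullet> y"
    and d: "d = (if ?g \<bullet> (u - w) \<ge> ?g \<bullet> (w - v) then u - w else w - v)"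
    using assms unfolding fdfw_direction_def is_arg_max_def is_arg_min_def by (metis not_less)
  have max: "?g \<bullet> d = max (?g \<bullet> (u - w)) (?g \<bullet> (w - v))" by (simp add: d)
  show "?g \<bullet> (y - w) \<le> ?g \<bullet> d" if "y \<in> Q" for y
    using u(2)[OF that] unfolding max by (simp add: inner_diff_right)
  show "?g \<bullet> (w - y) \<le> ?g \<bullet> d" if "y \<in> minimal_face Q w" for y
    using v(2)[OF that] unfolding max by (simp add: inner_diff_right)
  show "(\<exists>u\<in>Q. d = u - w \<and> (\<forall>v\<in>Q. ?g \<bullet> v \<le> ?g \<bullet> u)) \<or> (\<exists>v\<in>minimal_face Q w. d = w - v)"
    using u v d by (auto split: if_splits)
qed

lemma fdfw_direction_pos:
  assumes "fdfw_direction f Q w d" "\<not> stationary f Q w"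
  shows "0 < gradient f w \<bullet> d" "d \<noteq> 0"
proof -
  show "0 < gradient f w \<bullet> d"
    using assms(2) fdfw_direction_ge_FW[OF assms(1)] by (force simp: stationary_def)
  then show "d \<noteq> 0" by auto
qed

lemma
  assumes "fdfw_sequence f Q z d a" "\<not> stationary f Q (z k)"
  shows fdfw_sequence_direction: "fdfw_direction f Q (z k) (d k)"
    and fdfw_sequence_pos: "0 < a k"
    and fdfw_sequence_le_max_step: "a k \<le> max_step Q (z k) (d k)"
    and fdfw_sequence_Suc: "z (Suc k) = z k + a k *\<^sub>R d k"
proof -
  have "if stationary f Q (z k) then z (Suc k) = z k
          else fdfw_direction f Q (z k) (d k)
             \<and> 0 < a k \<and> a k \<le> max_step Q (z k) (d k)
             \<and> z (Suc k) = z k + a k *\<^sub>R d k"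
    using assms(1) by (simp add: fdfw_sequence_def)
  then show "fdfw_direction f Q (z k) (d k)" "0 < a k" "a k \<le> max_step Q (z k) (d k)"
    "z (Suc k) = z k + a k *\<^sub>R d k" using assms(2) by auto
qed

lemma fdfw_sequence_Suc_stationary:
  assumes "fdfw_sequence f Q z d a" "stationary f Q (z k)"
  shows "z (Suc k) = z k"
proof -
  have "if stationary f Q (z k) then z (Suc k) = z k
          else fdfw_direction f Q (z k) (d k)
             \<and> 0 < a k \<and> a k \<le> max_step Q (z k) (d k)
             \<and> z (Suc k) = z k + a k *\<^sub>R d k"
    using assms(1) by (simp add: fdfw_sequence_def)
  then show ?thesis using assms(2) by simp
qed

lemma fdfw_sequence_mem:
  assumes "fdfw_sequence f Q z d a" "compact Q" "convex Q"
  shows "z k \<in> Q"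
proof (induction k)
  case 0
  then show ?case using assms by (simp add: fdfw_sequence_def)
next
  case (Suc k)
  show ?case
  proof (cases "stationary f Q (z k)")
    case True
    then show ?thesis using Suc fdfw_sequence_Suc_stationary[OF assms(1)] by simp
  next
    case False
    note step = fdfw_sequence_direction[OF assms(1) False] fdfw_sequence_pos[OF assms(1) False]
      fdfw_sequence_le_max_step[OF assms(1) False]
    show ?thesis
      unfolding fdfw_sequence_Suc[OF assms(1) False]
      using step_mem[OF assms(2,3) Suc _ step(2,3)] fdfw_direction_pos(2)[OF step(1) False] by simp
  qed
qed

text \<open>The method has no memory, so statements about the first iterates transfer to any later
  starting index.\<close>

lemma fdfw_sequence_shift:
  assumes "fdfw_sequence f Q z d a" "compact Q" "convex Q"
  shows "fdfw_sequence f Q (\<lambda>k. z (k + m)) (\<lambda>k. d (k + m)) (\<lambda>k. a (k + m))"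
  using fdfw_sequence_mem[OF assms, of m] assms(1) by (simp add: fdfw_sequence_def)

lemma stepsize_S1_shift:
  "stepsize_S1 f Q c z d a \<Longrightarrow> stepsize_S1 f Q c (\<lambda>k. z (k + m)) (\<lambda>k. d (k + m)) (\<lambda>k. a (k + m))"
  by (simp add: stepsize_S1_def)

section \<open>Nondegenerate maximizers\<close>

text \<open>
  The face \<open>F\<close> is exposed by the gradient at \<open>p\<close>; that \<open>p\<close> is a relative interior point of it is
  strict complementarity.
\<close>

locale nondegenerate_maximizer =
  fixes f :: "'a::euclidean_space \<Rightarrow> real" and G :: "'a \<Rightarrow> 'a" and Q F :: "'a set"
    and p :: 'a and \<mu> :: real
  assumes polytope: "polytope Q"
    and GDERIV: "\<And>w. GDERIV f w :> G w"
    and isCont_G: "isCont G p"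
    and first_order: "\<And>q. q \<in> Q \<Longrightarrow> G p \<bullet> (q - p) \<le> 0"
    and F_eq: "F = {q \<in> Q. G p \<bullet> (q - p) = 0}"
    and p_rel_interior: "p \<in> rel_interior F"
    and mu_pos: "0 < \<mu>"
    and f_on_F: "\<And>q. q \<in> F \<Longrightarrow> f q = f p - \<mu> * (dist q p)\<^sup>2"
begin

section \<open>Elementary properties of the exposed face\<close>

lemma compact_Q: "compact Q" and convex_Q: "convex Q"
  using polytope by (auto simp: polytope_imp_compact polytope_imp_convex)

lemma gradient_f: "gradient f w = G w"
  using GDERIV gradient_eq by blast

lemma p_mem_F: "p \<in> F"
  using p_rel_interior rel_interior_subset by blast

lemma F_subset: "F \<subseteq> Q" by (auto simp: F_eq)

lemma F_face: "F face_of Q"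
proof -
  have "Q \<inter> {x. G p \<bullet> x = G p \<bullet> p} face_of Q"
    using convex_Q first_order
    by (intro face_of_Int_supporting_hyperplane_le) (auto simp: inner_diff_right)
  moreover have "F = Q \<inter> {x. G p \<bullet> x = G p \<bullet> p}" by (auto simp: F_eq inner_diff_right)
  ultimately show ?thesis by simp
qed

lemma convex_F: "convex F" using F_face face_of_imp_convex by blast

lemma diameter_bound: obtains B where "0 < B" "\<And>u w. u \<in> Q \<Longrightarrow> w \<in> Q \<Longrightarrow> norm (u - w) \<le> B"
proof -
  obtain b where b: "\<And>u. u \<in> Q \<Longrightarrow> norm u \<le> b"
    using compact_Q compact_imp_bounded bounded_iff by metis
  then have "norm (u - w) \<le> \<bar>b\<bar> + \<bar>b\<bar> + 1" if "u \<in> Q" "w \<in> Q" for u w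
    using that(1)[THEN b] that(2)[THEN b] norm_triangle_ineq4[of u w] by linarith
  then show thesis using that[of "\<bar>b\<bar> + \<bar>b\<bar> + 1"] by auto
qed

section \<open>First-order estimates in a neighborhood of \<open>p\<close>\<close>

lemma tendsto_G: "(G \<longlongrightarrow> G p) (nhds p)"
  using isCont_G by (simp add: isCont_def tendsto_at_iff_tendsto_nhds)

text \<open>At \<open>p\<close> every vertex off \<open>F\<close> has a positive gap, by first-order
  optimality and the choice of \<open>F\<close>. Finiteness of the vertex set makes it uniform, and
  continuity of \<open>G\<close> carries it to a neighborhood. The first inequality makes moving
  away from \<open>v\<close> profitable, the second prevents \<open>v\<close> from maximizing the
  linearization.\<close>

lemma vertex_gap:
  obtains \<delta> where "0 < \<delta>"
    "\<forall>\<^sub>F w in nhds p. \<forall>v. v extreme_point_of Q \<longrightarrow> v \<notin> F \<longrightarrow> \<delta> < G w \<bullet> (w - v) \<and> 0 < G w \<bullet> (p - v)"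
proof -
  let ?X = "{v. v extreme_point_of Q \<and> v \<notin> F}"
  have "finite {v. v extreme_point_of Q}"
    using polytope finite_polyhedron_extreme_points polytope_imp_polyhedron by blast
  then have fin: "finite ?X" by (rule rev_finite_subset) auto
  have pos: "0 < G p \<bullet> (p - v)" if "v \<in> ?X" for v
    using that first_order[of v] by (fastforce simp: F_eq extreme_point_of_def inner_diff_right)
  obtain \<delta> where \<delta>: "0 < \<delta>" "\<And>v. v \<in> ?X \<Longrightarrow> \<delta> < G p \<bullet> (p - v)"
  proof (cases "?X = {}")
    case True
    then show ?thesis using that[of 1] by auto
  next
    case False
    let ?m = "Min ((\<lambda>v. G p \<bullet> (p - v)) ` ?X)"
    have "0 < ?m" using False fin pos by (subst Min_gr_iff) auto
    moreover have "?m \<le> G p \<bullet> (p - v)" if "v \<in> ?X" for v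
      using fin that by (intro Min_le) auto
    \<comment> \<open>Half the minimal gap makes the inequality strict.\<close>
    ultimately show ?thesis using that[of "?m / 2"] by fastforce
  qed
  have "\<forall>\<^sub>F w in nhds p. \<forall>v\<in>?X. \<delta> < G w \<bullet> (w - v) \<and> 0 < G w \<bullet> (p - v)"
  proof (rule eventually_ball_finite[OF fin], intro ballI eventually_conj)
    fix v assume v: "v \<in> ?X"
    have "((\<lambda>w. G w \<bullet> (w - v)) \<longlongrightarrow> G p \<bullet> (p - v)) (nhds p)"
      by (intro tendsto_intros tendsto_G filterlim_ident)
    then show "\<forall>\<^sub>F w in nhds p. \<delta> < G w \<bullet> (w - v)" by (rule order_tendstoD) (use \<delta>(2) v in blast)
    have "((\<lambda>w. G w \<bullet> (p - v)) \<longlongrightarrow> G p \<bullet> (p - v)) (nhds p)"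
      by (intro tendsto_intros tendsto_G)
    then show "\<forall>\<^sub>F w in nhds p. 0 < G w \<bullet> (p - v)" by (rule order_tendstoD) (use pos v in blast)
  qed
  then have "\<forall>\<^sub>F w in nhds p. \<forall>v. v extreme_point_of Q \<longrightarrow> v \<notin> F
      \<longrightarrow> \<delta> < G w \<bullet> (w - v) \<and> 0 < G w \<bullet> (p - v)"
    by (rule eventually_mono) blast
  then show thesis by (rule that[OF \<delta>(1)])
qed

text \<open>The gap is at most 0 at \<open>p\<close>. The error from replacing \<open>p\<close> by
  \<open>w\<close> is uniform in \<open>u\<close> because \<open>Q\<close> is bounded.\<close>

lemma FW_gap_small:
  assumes "0 < \<epsilon>"
  shows "\<forall>\<^sub>F w in nhds p. \<forall>u\<in>Q. G w \<bullet> (u - w) < \<epsilon>"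
proof -
  obtain B where B: "0 < B" "\<And>u w. u \<in> Q \<Longrightarrow> w \<in> Q \<Longrightarrow> norm (u - w) \<le> B"
    using diameter_bound by blast
  have "((\<lambda>w. norm (G w - G p) * B + G w \<bullet> (p - w)) \<longlongrightarrow> norm (G p - G p) * B + G p \<bullet> (p - p)) (nhds p)"
    by (intro tendsto_intros tendsto_G filterlim_ident)
  then have "\<forall>\<^sub>F w in nhds p. norm (G w - G p) * B + G w \<bullet> (p - w) < \<epsilon>"
    by (rule order_tendstoD) (use assms in simp)
  then show ?thesis
  proof eventually_elim
    case (elim w)
    show ?case
    proof
      fix u assume u: "u \<in> Q"
      have "G w \<bullet> (u - w) = G p \<bullet> (u - p) + (G w - G p) \<bullet> (u - p) + G w \<bullet> (p - w)"
        by (simp add: algebra_simps)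
      also have "\<dots> \<le> 0 + norm (G w - G p) * B + G w \<bullet> (p - w)"
      proof (intro add_mono first_order u order.refl)
        have "(G w - G p) \<bullet> (u - p) \<le> norm (G w - G p) * norm (u - p)"
          by (rule norm_cauchy_schwarz)
        also have "\<dots> \<le> norm (G w - G p) * B"
          using B(2) u p_mem_F F_subset by (intro mult_left_mono) auto
        finally show "(G w - G p) \<bullet> (u - p) \<le> norm (G w - G p) * B" .
      qed
      finally show "G w \<bullet> (u - w) < \<epsilon>" using elim by simp
    qed
  qed
qed

text \<open>A face is the convex hull of its extreme points, and \<open>F\<close> is convex, so
  these cannot all lie in \<open>F\<close>.\<close>

lemma extreme_point_not_mem_F:
  assumes "M face_of Q" "\<not> M \<subseteq> F"
  obtains v where "v \<in> M" "v extreme_point_of Q" "v \<notin> F"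
proof -
  have "M = convex hull {v. v extreme_point_of M}"
    using Krein_Milman_Minkowski face_of_imp_compact[OF convex_Q compact_Q assms(1)]
      face_of_imp_convex[OF assms(1)] by blast
  then have "\<not> {v. v extreme_point_of M} \<subseteq> F"
    using assms(2) convex_F hull_minimal by metis
  then show thesis using that extreme_point_of_face[OF assms(1)] by auto
qed

text \<open>
  Off \<open>F\<close> the in-face direction gains at least \<open>\<delta>\<close> to first order, whereas the gain of any feasible
  displacement tends to \<open>0\<close>. So near \<open>p\<close> the method takes an in-face direction and the maximal step
  along it is short.
\<close>

lemma not_stationary_near: "\<forall>\<^sub>F w in nhds p. w \<in> Q \<longrightarrow> w \<notin> F \<longrightarrow> \<not> stationary f Q w"
proof -
  obtain \<delta> where \<delta>: "0 < \<delta>" and ev: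
    "\<forall>\<^sub>F w in nhds p. \<forall>v. v extreme_point_of Q \<longrightarrow> v \<notin> F \<longrightarrow> \<delta> < G w \<bullet> (w - v) \<and> 0 < G w \<bullet> (p - v)"
    by (rule vertex_gap)
  from ev show ?thesis
  proof (eventually_elim, intro impI notI)
    fix w assume gap: "\<forall>v. v extreme_point_of Q \<longrightarrow> v \<notin> F \<longrightarrow> \<delta> < G w \<bullet> (w - v) \<and> 0 < G w \<bullet> (p - v)"
      and w: "w \<in> Q" "w \<notin> F" and stat: "stationary f Q w"
    let ?M = "minimal_face Q w"
    have face: "?M face_of Q" using minimal_face_face_of convex_Q w(1) .
    obtain v where v: "v \<in> ?M" "v extreme_point_of Q" "v \<notin> F"
      using extreme_point_not_mem_F[OF face] w mem_minimal_face[of w Q] by blast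
    \<comment> \<open>\<open>w\<close> is relatively interior to its minimal face, so the segment
      from \<open>v\<close> extends beyond \<open>w\<close>; thus \<open>w - v\<close> is a feasible
      direction with slope above \<open>\<delta>\<close>.\<close>
    obtain e where e: "e > 1" "(1 - e) *\<^sub>R v + e *\<^sub>R w \<in> ?M"
      using minimal_face_rel_interior[OF convex_Q w(1)] convex_rel_interior_iff[of ?M w]
        face_of_imp_convex[OF face] v(1) by blast
    have eq: "(1 - e) *\<^sub>R v + e *\<^sub>R w - w = (e - 1) *\<^sub>R (w - v)" by (simp add: algebra_simps)
    have "(1 - e) *\<^sub>R v + e *\<^sub>R w \<in> Q" using e(2) face face_of_imp_subset by blast
    then have "G w \<bullet> ((1 - e) *\<^sub>R v + e *\<^sub>R w - w) \<le> 0"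
      using stat by (simp add: stationary_def gradient_f)
    then have "(e - 1) * (G w \<bullet> (w - v)) \<le> 0" unfolding eq by simp
    moreover have "0 < (e - 1) * (G w \<bullet> (w - v))" using e(1) gap v \<delta> by fastforce
    ultimately show False by simp
  qed
qed

text \<open>A maximal in-face step ends on the relative boundary of the minimal face, hence in a
  proper face of smaller dimension. The lower stepsize bound forces maximality since the maximal
  step is tiny.\<close>

lemma step_near:
  assumes "0 < c" "0 < r"
  shows "\<forall>\<^sub>F w in nhds p. \<forall>d a. w \<in> Q \<longrightarrow> w \<notin> F \<longrightarrow> fdfw_direction f Q w d \<longrightarrow> 0 < a
    \<longrightarrow> a \<le> max_step Q w d \<longrightarrow> step_bound f Q c w d \<le> a
    \<longrightarrow> dist (w + a *\<^sub>R d) p < r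
      \<and> aff_dim (minimal_face Q (w + a *\<^sub>R d)) < aff_dim (minimal_face Q w)"
proof -
  obtain \<delta> where \<delta>: "0 < \<delta>" and ev1:
    "\<forall>\<^sub>F w in nhds p. \<forall>v. v extreme_point_of Q \<longrightarrow> v \<notin> F \<longrightarrow> \<delta> < G w \<bullet> (w - v) \<and> 0 < G w \<bullet> (p - v)"
    by (rule vertex_gap)
  obtain B where B: "0 < B" "\<And>u w. u \<in> Q \<Longrightarrow> w \<in> Q \<Longrightarrow> norm (u - w) \<le> B"
    using diameter_bound by blast
  \<comment> \<open>The three bounds exclude the Frank-Wolfe direction, make \<open>max_step\<close>
    the smaller term of \<open>step_bound\<close>, and limit the displacement to
    \<open>r / 2\<close>.\<close>
  define \<epsilon> where "\<epsilon> = min \<delta> (min (c * \<delta>\<^sup>2 / B\<^sup>2) (\<delta> * r / (2 * B)))"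
  have \<epsilon>: "0 < \<epsilon>" "\<epsilon> \<le> \<delta>" "\<epsilon> \<le> c * \<delta>\<^sup>2 / B\<^sup>2" "\<epsilon> \<le> \<delta> * r / (2 * B)"
    using \<delta> B assms by (auto simp: \<epsilon>_def)
  have "\<forall>\<^sub>F w in nhds p. dist w p < r / 2"
    using assms unfolding eventually_nhds_metric by (intro exI[of _ "r / 2"]) auto
  from this ev1 FW_gap_small[OF \<epsilon>(1)] show ?thesis
  proof (eventually_elim, intro allI impI)
    fix w d and a :: real
    assume near: "dist w p < r / 2"
      and gap: "\<forall>v. v extreme_point_of Q \<longrightarrow> v \<notin> F \<longrightarrow> \<delta> < G w \<bullet> (w - v) \<and> 0 < G w \<bullet> (p - v)"
      and FW: "\<forall>u\<in>Q. G w \<bullet> (u - w) < \<epsilon>"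
      and w: "w \<in> Q" "w \<notin> F" and dir: "fdfw_direction f Q w d"
      and a: "0 < a" "a \<le> max_step Q w d" and bound: "step_bound f Q c w d \<le> a"
    let ?M = "minimal_face Q w" and ?m = "max_step Q w d" and ?w' = "w + a *\<^sub>R d"
    have face: "?M face_of Q" using minimal_face_face_of convex_Q w(1) .
    then have sub: "?M \<subseteq> Q" by (rule face_of_imp_subset)
    obtain v where v: "v \<in> ?M" "v extreme_point_of Q" "v \<notin> F"
      using extreme_point_not_mem_F[OF face] w mem_minimal_face[of w Q] by blast
    have gd: "\<delta> < G w \<bullet> d"
      using fdfw_direction_ge_FD[OF dir v(1)] gap v by (fastforce simp: gradient_f)
    then have "d \<noteq> 0" using \<delta> by auto
    note max_step = max_step_nonneg[OF compact_Q w(1) \<open>d \<noteq> 0\<close>] max_step_mem[OF compact_Q w(1) \<open>d \<noteq> 0\<close>]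
      le_max_step[OF compact_Q w(1) \<open>d \<noteq> 0\<close>]
    \<comment> \<open>A Frank-Wolfe direction would have slope below
      \<open>\<epsilon> \<le> \<delta>\<close>.\<close>
    obtain v0 where v0: "v0 \<in> ?M" "d = w - v0"
      using fdfw_direction_cases[OF dir] FW gd \<epsilon>(2) by fastforce
    have nd: "norm d \<le> B" using B(2)[OF w(1), of v0] v0 sub by auto
    \<comment> \<open>The endpoint of the maximal step is itself a competitor \<open>u\<close> in
      the Frank-Wolfe gap.\<close>
    have "?m * (G w \<bullet> d) < \<epsilon>"
      using FW[rule_format, OF max_step(2)] by simp
    moreover have "?m * \<delta> \<le> ?m * (G w \<bullet> d)" using max_step(1) gd by (intro mult_left_mono) auto
    ultimately have m\<delta>: "?m * \<delta> < \<epsilon>" by simp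
    have "?m < \<epsilon> / \<delta>" using m\<delta> \<delta> by (simp add: field_simps)
    also have "\<dots> \<le> c * \<delta> / B\<^sup>2"
      using \<epsilon>(3) \<delta> by (simp add: field_simps power2_eq_square)
    also have "\<dots> \<le> c * ((G w \<bullet> d) / (norm d)\<^sup>2)"
    proof -
      have "\<delta> / B\<^sup>2 \<le> (G w \<bullet> d) / (norm d)\<^sup>2"
        using gd nd \<delta> \<open>d \<noteq> 0\<close> by (intro frac_le power_mono) auto
      then have "c * (\<delta> / B\<^sup>2) \<le> c * ((G w \<bullet> d) / (norm d)\<^sup>2)"
        using assms(1) by (intro mult_left_mono) auto
      then show ?thesis by simp
    qed
    finally have "a = ?m"
      using bound a by (auto simp: step_bound_def gradient_f min_def split: if_splits)
    have w'Q: "?w' \<in> Q" using step_mem[OF compact_Q convex_Q w(1) \<open>d \<noteq> 0\<close> a] .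
    have "dist ?w' p \<le> a * norm d + dist w p"
      using dist_triangle[of ?w' p w] a(1) by (simp add: dist_norm)
    also have "a * norm d \<le> a * B" using nd a by simp
    also have "a * B \<le> r / 2"
    proof -
      have "a * \<delta> < \<delta> * r / (2 * B)" using m\<delta> \<epsilon>(4) \<open>a = ?m\<close> by simp
      then show ?thesis using \<delta> B(1) by (simp add: field_simps)
    qed
    finally have "dist ?w' p < r" using near by simp
    moreover have "aff_dim (minimal_face Q ?w') < aff_dim ?M"
    proof -
      let ?M' = "minimal_face Q ?w'"
      have "?w' - v0 = (1 + a) *\<^sub>R d" by (simp add: v0(2) algebra_simps)
      then have "v0 \<noteq> ?w'" using a(1) \<open>d \<noteq> 0\<close> by auto
      \<comment> \<open>With \<open>v0 = w - d\<close> and \<open>?w' = w + a d\<close>, this weight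
        places \<open>w\<close> strictly between them, so the face property puts \<open>?w'\<close>
        into \<open>?M\<close>.\<close>
      moreover obtain \<theta> where \<theta>: "0 < \<theta>" "\<theta> < 1" "\<theta> * (1 + a) = 1"
        using a(1) by (intro that[of "1 / (1 + a)"]) auto
      moreover have "w = (1 - \<theta>) *\<^sub>R v0 + \<theta> *\<^sub>R ?w'"
      proof -
        have v0_eq: "v0 = w - d" using v0(2) by simp
        have "(1 - \<theta>) *\<^sub>R v0 + \<theta> *\<^sub>R ?w' = w + (\<theta> * (1 + a) - 1) *\<^sub>R d"
          unfolding v0_eq by (simp add: algebra_simps)
        then show ?thesis using \<theta>(3) by simp
      qed
      ultimately have "w \<in> open_segment v0 ?w'"
        unfolding in_segment by blast
      then have "?w' \<in> ?M"
        using face_ofD[OF face _ _ w'Q mem_minimal_face] v0(1) sub by blast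
      then have subM: "?M' \<subseteq> ?M" using minimal_face_subset face by blast
      have face': "?M' face_of ?M"
        using face_of_subset[OF minimal_face_face_of[OF convex_Q w'Q] subM sub] .
      have "?M' \<noteq> ?M"
      proof
        \<comment> \<open>Then \<open>?w'\<close> would be relatively interior to \<open>?M\<close>,
          and prolonging the segment from \<open>v0\<close> would give a feasible step longer than
          the maximal one.\<close>
        assume eq: "?M' = ?M"
        obtain e where e: "e > 1" "(1 - e) *\<^sub>R v0 + e *\<^sub>R ?w' \<in> ?M"
          using minimal_face_rel_interior[OF convex_Q w'Q] convex_rel_interior_iff[of ?M ?w']
            face_of_imp_convex[OF face] v0(1) unfolding eq by blast
        have v0_eq: "v0 = w - d" using v0(2) by simp
        have "(1 - e) *\<^sub>R v0 + e *\<^sub>R ?w' = w + (a + (e - 1) * (1 + a)) *\<^sub>R d"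
          unfolding v0_eq by (simp add: algebra_simps)
        then have "w + (a + (e - 1) * (1 + a)) *\<^sub>R d \<in> Q" using e(2) sub by auto
        then have "a + (e - 1) * (1 + a) \<le> ?m"
          using max_step(3) a(1) e(1) by simp
        moreover have "0 < (e - 1) * (1 + a)" using a(1) e(1) by simp
        ultimately show False using \<open>a = ?m\<close> by linarith
      qed
      then show ?thesis
        using face_of_aff_dim_lt[OF face_of_imp_convex[OF face] face'] by simp
    qed
    ultimately show "dist ?w' p < r \<and> aff_dim (minimal_face Q ?w') < aff_dim ?M" by simp
  qed
qed

text \<open>Each step off \<open>F\<close> lowers the dimension of the minimal face, so induction on
  a bound \<open>D\<close> for it works. The radius is built backwards: the first step must land
  within the radius obtained for the smaller dimension.\<close>

lemma enters_F:
  assumes "0 < c" "0 < R"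
  shows "\<exists>r>0. \<forall>z d a. fdfw_sequence f Q z d a \<longrightarrow> stepsize_S1 f Q c z d a \<longrightarrow> dist (z 0) p < r
    \<longrightarrow> aff_dim (minimal_face Q (z 0)) \<le> int D
    \<longrightarrow> (\<exists>i. int i \<le> aff_dim (minimal_face Q (z 0)) \<and> z i \<in> F \<and> dist (z i) p < R)"
proof (induction D)
  \<comment> \<open>The affine dimension is negative only for the empty set.\<close>
  have dim_nonneg: "0 \<le> aff_dim (minimal_face Q w)" for w
    using mem_minimal_face[of w Q] aff_dim_negative_iff[of "minimal_face Q w"] by (metis empty_iff not_less)
  have step: "\<exists>r>0. r \<le> R \<and> (\<forall>z d a. fdfw_sequence f Q z d a \<longrightarrow> stepsize_S1 f Q c z d a \<longrightarrow> dist (z 0) p < r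
    \<longrightarrow> z 0 \<notin> F \<longrightarrow> dist (z 1) p < r'
      \<and> aff_dim (minimal_face Q (z 1)) < aff_dim (minimal_face Q (z 0)))" if r': "0 < r'" for r'
  proof -
    obtain r1 where r1: "0 < r1" "\<And>w. dist w p < r1 \<Longrightarrow> w \<in> Q \<Longrightarrow> w \<notin> F \<Longrightarrow> \<not> stationary f Q w"
      using not_stationary_near unfolding eventually_nhds_metric by blast
    obtain r2 where r2: "0 < r2" "\<And>w d a. dist w p < r2 \<Longrightarrow> w \<in> Q \<Longrightarrow> w \<notin> F \<Longrightarrow> fdfw_direction f Q w d
       \<Longrightarrow> 0 < a \<Longrightarrow> a \<le> max_step Q w d \<Longrightarrow> step_bound f Q c w d \<le> a
       \<Longrightarrow> dist (w + a *\<^sub>R d) p < r'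
        \<and> aff_dim (minimal_face Q (w + a *\<^sub>R d)) < aff_dim (minimal_face Q w)"
      using step_near[OF \<open>0 < c\<close> r'] unfolding eventually_nhds_metric by blast
    show ?thesis
    \<comment> \<open>The bound by \<open>R\<close> serves sequences that already start in
      \<open>F\<close>, where \<open>i = 0\<close> is the witness.\<close>
    proof (intro exI[of _ "min R (min r1 r2)"] conjI allI impI)
      fix z d a
      assume z: "fdfw_sequence f Q z d a" "stepsize_S1 f Q c z d a" "dist (z 0) p < min R (min r1 r2)" "z 0 \<notin> F"
      have Q: "z 0 \<in> Q" using z(1) by (simp add: fdfw_sequence_def)
      have ns: "\<not> stationary f Q (z 0)" using r1(2) z Q by simp
      have "step_bound f Q c (z 0) (d 0) \<le> a 0"
        using z(2) ns by (simp add: stepsize_S1_def)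
      then have "dist (z 0 + a 0 *\<^sub>R d 0) p < r'
        \<and> aff_dim (minimal_face Q (z 0 + a 0 *\<^sub>R d 0)) < aff_dim (minimal_face Q (z 0))"
        using r2(2)[of "z 0" "d 0" "a 0"] z Q fdfw_sequence_direction[OF z(1) ns]
          fdfw_sequence_pos[OF z(1) ns] fdfw_sequence_le_max_step[OF z(1) ns] by simp
      then show "dist (z 1) p < r'" "aff_dim (minimal_face Q (z 1)) < aff_dim (minimal_face Q (z 0))"
        using fdfw_sequence_Suc[OF z(1) ns] by auto
    qed (use r1 r2 assms in auto)
  qed
  {
    case 0
    obtain r where r: "0 < r" "r \<le> R" "\<forall>z d a. fdfw_sequence f Q z d a \<longrightarrow> stepsize_S1 f Q c z d a
      \<longrightarrow> dist (z 0) p < r \<longrightarrow> z 0 \<notin> F \<longrightarrow> dist (z 1) p < 1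
      \<and> aff_dim (minimal_face Q (z 1)) < aff_dim (minimal_face Q (z 0))"
      using step[of 1] by auto
    show ?case
    proof (intro exI[of _ r] conjI allI impI r(1))
      fix z d a
      assume z: "fdfw_sequence f Q z d a" "stepsize_S1 f Q c z d a" "dist (z 0) p < r"
        "aff_dim (minimal_face Q (z 0)) \<le> int 0"
      \<comment> \<open>Off \<open>F\<close> the next minimal face would have negative dimension;
        the radius 1 for the next iterate is arbitrary.\<close>
      have "z 0 \<in> F" using r(3) z dim_nonneg[of "z 1"] by (smt (verit) of_nat_0)
      then show "\<exists>i. int i \<le> aff_dim (minimal_face Q (z 0)) \<and> z i \<in> F \<and> dist (z i) p < R"
        using z r dim_nonneg[of "z 0"] by (intro exI[of _ 0]) auto
    qed
  next
    case (Suc D)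
    obtain r' where r': "0 < r'" "\<And>z d a. fdfw_sequence f Q z d a \<Longrightarrow> stepsize_S1 f Q c z d a \<Longrightarrow> dist (z 0) p < r'
      \<Longrightarrow> aff_dim (minimal_face Q (z 0)) \<le> int D
      \<Longrightarrow> \<exists>i. int i \<le> aff_dim (minimal_face Q (z 0)) \<and> z i \<in> F \<and> dist (z i) p < R"
      using Suc.IH by blast
    obtain r where r: "0 < r" "r \<le> R" "\<And>z d a. fdfw_sequence f Q z d a \<Longrightarrow> stepsize_S1 f Q c z d a
      \<Longrightarrow> dist (z 0) p < r \<Longrightarrow> z 0 \<notin> F \<Longrightarrow> dist (z 1) p < r'
      \<and> aff_dim (minimal_face Q (z 1)) < aff_dim (minimal_face Q (z 0))"
      using step[OF r'(1)] by auto
    show ?case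
    proof (intro exI[of _ r] conjI allI impI r(1))
      fix z d a
      assume z: "fdfw_sequence f Q z d a" "stepsize_S1 f Q c z d a" "dist (z 0) p < r"
        "aff_dim (minimal_face Q (z 0)) \<le> int (Suc D)"
      show "\<exists>i. int i \<le> aff_dim (minimal_face Q (z 0)) \<and> z i \<in> F \<and> dist (z i) p < R"
      proof (cases "z 0 \<in> F")
        case True
        then show ?thesis using z r dim_nonneg[of "z 0"] by (intro exI[of _ 0]) auto
      next
        case False
        from r(3)[OF z(1-3) False] have 1: "dist (z 1) p < r'"
          "aff_dim (minimal_face Q (z 1)) < aff_dim (minimal_face Q (z 0))" by auto
        \<comment> \<open>The induction hypothesis applies to the run started at the next iterate;
          the shift by one is paid for by the drop in dimension.\<close>
        obtain i where "int i \<le> aff_dim (minimal_face Q (z 1))" "z (i + 1) \<in> F" "dist (z (i + 1)) p < R"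
          using r'(2)[OF fdfw_sequence_shift[OF z(1) compact_Q convex_Q, of 1]
              stepsize_S1_shift[OF z(2), of 1]] 1 z(4) by auto
        then show ?thesis using 1 by (intro exI[of _ "i + 1"]) auto
      qed
    qed
  }
qed

text \<open>Near \<open>p\<close> no vertex off \<open>F\<close> maximizes the linearization, so the
  Frank-Wolfe target lies in \<open>F\<close>; the in-face target does so since the minimal face of
  \<open>w\<close> is contained in \<open>F\<close>.\<close>

lemma stays_in_F:
  "\<forall>\<^sub>F w in nhds p. \<forall>d a. w \<in> F \<longrightarrow> fdfw_direction f Q w d \<longrightarrow> w + a *\<^sub>R d \<in> Q \<longrightarrow>
    w + d \<in> affine hull F \<and> w + a *\<^sub>R d \<in> F"
proof -
  obtain \<delta> where \<delta>: "0 < \<delta>" and ev: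
    "\<forall>\<^sub>F w in nhds p. \<forall>v. v extreme_point_of Q \<longrightarrow> v \<notin> F \<longrightarrow> \<delta> < G w \<bullet> (w - v) \<and> 0 < G w \<bullet> (p - v)"
    by (rule vertex_gap)
  from ev show ?thesis
  proof (eventually_elim, intro allI impI)
    fix w d and a :: real
    assume gap: "\<forall>v. v extreme_point_of Q \<longrightarrow> v \<notin> F \<longrightarrow> \<delta> < G w \<bullet> (w - v) \<and> 0 < G w \<bullet> (p - v)"
      and w: "w \<in> F" and dir: "fdfw_direction f Q w d" and w'Q: "w + a *\<^sub>R d \<in> Q"
    \<comment> \<open>The factor \<open>\<sigma>\<close> is 1 for a Frank-Wolfe direction and -1 for
      an in-face direction.\<close>
    have "\<exists>v\<in>F. \<exists>\<sigma>. d = \<sigma> *\<^sub>R (v - w)"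
      using fdfw_direction_cases[OF dir]
    proof (elim disjE bexE conjE)
      fix u assume u: "u \<in> Q" "d = u - w" "\<forall>v\<in>Q. gradient f w \<bullet> v \<le> gradient f w \<bullet> u"
      let ?M = "Q \<inter> {x. G w \<bullet> x = G w \<bullet> u}"
      have "?M face_of Q"
        using convex_Q u(3) by (intro face_of_Int_supporting_hyperplane_le) (auto simp: gradient_f)
      have "?M \<subseteq> F"
      proof (rule ccontr)
        assume "\<not> ?M \<subseteq> F"
        then obtain v where v: "v \<in> ?M" "v extreme_point_of Q" "v \<notin> F"
          using extreme_point_not_mem_F[OF \<open>?M face_of Q\<close>] by blast
        then have "0 < G w \<bullet> (p - v)" using gap by blast
        moreover have "G w \<bullet> p \<le> G w \<bullet> u" using u(3) p_mem_F F_subset by (auto simp: gradient_f)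
        ultimately show False using v(1) by (simp add: inner_diff_right)
      qed
      then show ?thesis using u by (intro bexI[of _ u] exI[of _ 1]) auto
    next
      fix v assume "v \<in> minimal_face Q w" "d = w - v"
      then show ?thesis
        using minimal_face_subset[OF F_face w] by (intro bexI[of _ v] exI[of _ "- 1"]) auto
    qed
    then obtain v \<sigma> where v: "v \<in> F" "d = \<sigma> *\<^sub>R (v - w)" by blast
    have "(1 - \<sigma>) *\<^sub>R w + \<sigma> *\<^sub>R v \<in> affine hull F"
      using w v(1) by (intro mem_affine[OF affine_affine_hull]) (auto simp: hull_inc)
    moreover have "(1 - \<sigma>) *\<^sub>R w + \<sigma> *\<^sub>R v = w + d" by (simp add: v(2) algebra_simps)
    \<comment> \<open>\<open>F\<close> is cut out of \<open>Q\<close> by one linear equation, which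
      is preserved along \<open>d\<close>; feasibility then gives membership.\<close>
    moreover have "G p \<bullet> d = 0" using w v by (simp add: F_eq inner_diff_right)
    then have "w + a *\<^sub>R d \<in> F"
      using w w'Q by (simp add: F_eq inner_diff_right inner_add_right)
    ultimately show "w + d \<in> affine hull F \<and> w + a *\<^sub>R d \<in> F" by simp
  qed
qed

text \<open>Along the segment from \<open>w\<close> to \<open>p\<close> the objective is the
  quadratic \<open>f p - \<mu> (1 - t)^2 (dist w p)^2\<close>; its slope at 0 measures how far
  \<open>w\<close> is from being stationary.\<close>

lemma gradient_on_F:
  assumes "w \<in> F"
  shows "G w \<bullet> (p - w) = 2 * \<mu> * (dist w p)\<^sup>2"
proof (cases "w = p")
  case False
  have seg: "w + t *\<^sub>R (p - w) \<in> F" if "0 \<le> t" "t \<le> 1" for t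
    using convexD_alt[OF convex_F assms p_mem_F that] by (simp add: algebra_simps)
  have "((\<lambda>t. f (w + t *\<^sub>R (p - w))) has_real_derivative G w \<bullet> (p - w)) (at 0)"
  proof -
    have "((\<lambda>t. w + t *\<^sub>R (p - w)) has_derivative (\<lambda>t. t *\<^sub>R (p - w))) (at 0)"
      by (auto intro!: derivative_eq_intros)
    moreover have "(f has_derivative (\<lambda>h. h \<bullet> G w)) (at (w + 0 *\<^sub>R (p - w)))"
      using GDERIV by (simp add: gderiv_def)
    ultimately have "((\<lambda>t. f (w + t *\<^sub>R (p - w))) has_derivative (\<lambda>t. t *\<^sub>R (p - w) \<bullet> G w)) (at 0)"
      using has_derivative_compose by fastforce
    then show ?thesis
      by (simp add: has_field_derivative_def inner_commute mult_commute_abs)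
  qed
  \<comment> \<open>The quadratic formula holds only inside \<open>F\<close>, so the two derivatives
    are compared within \<open>{0..1}\<close>.\<close>
  then have "((\<lambda>t. f (w + t *\<^sub>R (p - w))) has_real_derivative G w \<bullet> (p - w)) (at 0 within {0..1})"
    by (rule has_field_derivative_at_within)
  moreover have "((\<lambda>t. f (w + t *\<^sub>R (p - w))) has_real_derivative 2 * \<mu> * (dist w p)\<^sup>2) (at 0 within {0..1})"
  proof -
    have eq: "f (w + t *\<^sub>R (p - w)) = f p - \<mu> * ((1 - t)\<^sup>2 * (dist w p)\<^sup>2)" if "t \<in> {0..1}" for t
    proof -
      have "w + t *\<^sub>R (p - w) - p = (1 - t) *\<^sub>R (w - p)" by (simp add: algebra_simps)
      then have "dist (w + t *\<^sub>R (p - w)) p = \<bar>1 - t\<bar> * dist w p" by (simp add: dist_norm)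
      then show ?thesis using f_on_F[OF seg, of t] that by (simp add: power_mult_distrib)
    qed
    have "((\<lambda>t. f p - \<mu> * ((1 - t)\<^sup>2 * (dist w p)\<^sup>2)) has_real_derivative 2 * \<mu> * (dist w p)\<^sup>2) (at 0 within {0..1})"
      by (auto intro!: derivative_eq_intros)
    then show ?thesis
      by (rule has_field_derivative_transform_within[of _ _ _ _ 1]) (auto simp: eq)
  qed
  ultimately show ?thesis
    by (rule vector_derivative_unique_within[rotated, OF has_real_derivative_iff_has_vector_derivative[THEN iffD1] has_real_derivative_iff_has_vector_derivative[THEN iffD1]])
       (simp add: trivial_limit_within islimpt_Icc)
qed simp

text \<open>On \<open>F\<close> an increase of \<open>f\<close> is a decrease of the distance to
  \<open>p\<close>, so a monotone run cannot leave the ball. \<open>R1\<close> is chosen before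
  \<open>c\<close> and \<open>\<rho>\<close>, so it suits all of them.\<close>

lemma tail_in_F:
  assumes "0 < R"
  obtains R1 where "0 < R1" "R1 \<le> R"
    "\<And>z d a k0 k. fdfw_sequence f Q z d a \<Longrightarrow> incseq (\<lambda>k. f (z k)) \<Longrightarrow> z k0 \<in> F \<Longrightarrow> dist (z k0) p < R1
      \<Longrightarrow> k0 \<le> k \<Longrightarrow> z k \<in> F \<and> dist (z k) p < R1"
    "\<And>z d a k0 c \<rho>. fdfw_sequence f Q z d a \<Longrightarrow> incseq (\<lambda>k. f (z k)) \<Longrightarrow> z k0 \<in> F \<Longrightarrow> dist (z k0) p < R1
      \<Longrightarrow> 0 < c \<Longrightarrow> 0 < \<rho> \<Longrightarrow> stepsize_S2 f Q c \<rho> z d a \<Longrightarrow> z \<longlonglongrightarrow> p"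
proof -
  obtain r1 where r1: "0 < r1" "\<And>w d a. dist w p < r1 \<Longrightarrow> w \<in> F \<Longrightarrow> fdfw_direction f Q w d
      \<Longrightarrow> w + a *\<^sub>R d \<in> Q \<Longrightarrow> w + d \<in> affine hull F \<and> w + a *\<^sub>R d \<in> F"
    using stays_in_F unfolding eventually_nhds_metric by blast
  obtain r2 where r2: "0 < r2" "ball p r2 \<inter> affine hull F \<subseteq> F"
    using p_rel_interior unfolding mem_rel_interior_ball by blast
  obtain B where B: "0 < B" "\<And>u w. u \<in> Q \<Longrightarrow> w \<in> Q \<Longrightarrow> norm (u - w) \<le> B"
    using diameter_bound by blast
  \<comment> \<open>\<open>r1\<close> keeps the iterates in \<open>F\<close>; half of
    \<open>r2\<close> leaves room for a displacement of length \<open>r2 / 2\<close> inside the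
    relative interior ball.\<close>
  define R1 where "R1 = min R (min r1 (r2 / 2))"
  have R1: "0 < R1" "R1 \<le> R" "R1 \<le> r1" "R1 \<le> r2 / 2"
    using assms r1(1) r2(1) by (auto simp: R1_def)
  have one_step: "z (Suc k) \<in> F \<and> dist (z (Suc k)) p \<le> dist (z k) p"
    if z: "fdfw_sequence f Q z d a" "incseq (\<lambda>k. f (z k))" "z k \<in> F" "dist (z k) p < R1" for z d a k
  proof (cases "stationary f Q (z k)")
    case True
    then show ?thesis using z fdfw_sequence_Suc_stationary[OF z(1)] by simp
  next
    case False
    have F: "z (Suc k) \<in> F"
      using r1(2)[OF _ z(3) fdfw_sequence_direction[OF z(1) False], of "a k"] z(4) R1(3)
        fdfw_sequence_mem[OF z(1) compact_Q convex_Q, of "Suc k"]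
      by (simp add: fdfw_sequence_Suc[OF z(1) False])
    have "f (z k) \<le> f (z (Suc k))" using incseq_SucD[OF z(2)] .
    then have "\<mu> * (dist (z (Suc k)) p)\<^sup>2 \<le> \<mu> * (dist (z k) p)\<^sup>2"
      using f_on_F[OF F] f_on_F[OF z(3)] by linarith
    then have "(dist (z (Suc k)) p)\<^sup>2 \<le> (dist (z k) p)\<^sup>2"
      using mu_pos by (metis mult_le_cancel_left_pos)
    then show ?thesis using F power2_le_imp_le[OF _ zero_le_dist] by blast
  qed
  have tail: "z k \<in> F \<and> dist (z k) p < R1"
    if z: "fdfw_sequence f Q z d a" "incseq (\<lambda>k. f (z k))" "z k0 \<in> F" "dist (z k0) p < R1" "k0 \<le> k"
    for z d a k0 k
    using z(5)
  proof (induction k rule: dec_induct)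
    case (step n)
    then show ?case using one_step[OF z(1,2), of n] by auto
  qed (use z in auto)
  have conv: "z \<longlonglongrightarrow> p"
    if z: "fdfw_sequence f Q z d a" "incseq (\<lambda>k. f (z k))" "z k0 \<in> F" "dist (z k0) p < R1"
      and c: "0 < c" and \<rho>: "0 < \<rho>" and S2: "stepsize_S2 f Q c \<rho> z d a"
    for z d a k0 c \<rho>
  proof (rule ccontr)
    note tail = tail[OF z]
    assume "\<not> z \<longlonglongrightarrow> p"
    then obtain \<eta> where \<eta>: "0 < \<eta>" "\<And>N. \<exists>k\<ge>N. \<eta> \<le> dist (z k) p"
      unfolding lim_sequentially by (meson not_less)
    \<comment> \<open>Distances decrease, so being far infinitely often means being far
      always.\<close>
    have far: "\<eta> \<le> dist (z k) p" if "k0 \<le> k" for k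
    proof -
      obtain k' where k': "k \<le> k'" "\<eta> \<le> dist (z k') p" using \<eta>(2) by blast
      have "dist (z k') p \<le> dist (z k) p"
        using k'(1)
      proof (induction k' rule: dec_induct)
        case (step n)
        then show ?case
          using one_step[OF z(1,2), of n] tail[of n] that by (auto intro: order.trans)
      qed simp
      then show ?thesis using k'(2) by simp
    qed
    \<comment> \<open>\<open>\<gamma>\<close> bounds the slope towards \<open>p\<close> from below
      at distance at least \<open>\<eta>\<close>; \<open>\<tau>\<close> bounds
      \<open>step_bound\<close> from below, one term for each of its two arguments.\<close>
    define \<gamma> where "\<gamma> = 2 * \<mu> * \<eta>\<^sup>2"
    define \<tau> where "\<tau> = min (r2 / (2 * B)) (c * (\<gamma> / B\<^sup>2))"
    have pos: "0 < \<gamma>" "0 < \<tau>"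
      using \<eta>(1) mu_pos B(1) c r2(1) by (auto simp: \<gamma>_def \<tau>_def)
    have gain: "f (z k) + \<rho> * \<tau> * \<gamma> \<le> f (z (Suc k))" if "k0 \<le> k" for k
    proof -
      let ?w = "z k" and ?d = "d k"
      have w: "?w \<in> F" "dist ?w p < R1" using tail[OF that] by auto
      then have wQ: "?w \<in> Q" using F_subset by blast
      have "\<eta>\<^sup>2 \<le> (dist ?w p)\<^sup>2" using far[OF that] \<eta>(1) by (intro power_mono) auto
      then have g: "\<gamma> \<le> G ?w \<bullet> (p - ?w)"
        unfolding gradient_on_F[OF w(1)] \<gamma>_def using mu_pos by simp
      have pQ: "p \<in> Q" using p_mem_F F_subset by blast
      have ns: "\<not> stationary f Q ?w"
        using g pos(1) pQ by (force simp: stationary_def gradient_f)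
      note dir = fdfw_sequence_direction[OF z(1) ns]
      have gd: "\<gamma> \<le> G ?w \<bullet> ?d"
        using fdfw_direction_ge_FW[OF dir pQ] g by (simp add: gradient_f)
      have d0: "?d \<noteq> 0" using fdfw_direction_pos(2)[OF dir ns] .
      have nd: "norm ?d \<le> B"
        using fdfw_direction_cases[OF dir] B(2) wQ
          minimal_face_face_of[OF convex_Q wQ, THEN face_of_imp_subset] by auto
      have "?w + ?d \<in> affine hull F"
        \<comment> \<open>Stepsize 0 is trivially feasible and gives the affine hull part.\<close>
        using r1(2)[OF _ w(1) dir, of 0] w wQ R1(3) by simp
      then have "(1 - r2 / (2 * B)) *\<^sub>R ?w + (r2 / (2 * B)) *\<^sub>R (?w + ?d) \<in> affine hull F"
        using w(1) by (intro mem_affine[OF affine_affine_hull]) (auto simp: hull_inc)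
      also have "(1 - r2 / (2 * B)) *\<^sub>R ?w + (r2 / (2 * B)) *\<^sub>R (?w + ?d) = ?w + (r2 / (2 * B)) *\<^sub>R ?d"
        by (simp add: algebra_simps)
      finally have hull: "?w + (r2 / (2 * B)) *\<^sub>R ?d \<in> affine hull F" .
      have "norm ((r2 / (2 * B)) *\<^sub>R ?d) \<le> r2 / 2"
      proof -
        have "norm ((r2 / (2 * B)) *\<^sub>R ?d) = (r2 / (2 * B)) * norm ?d" using r2(1) B(1) by simp
        also have "\<dots> \<le> (r2 / (2 * B)) * B" using nd r2(1) B(1) by (intro mult_left_mono) auto
        finally show ?thesis using B(1) by simp
      qed
      then have "dist (?w + (r2 / (2 * B)) *\<^sub>R ?d) p < r2"
        using dist_triangle[of "?w + (r2 / (2 * B)) *\<^sub>R ?d" p ?w] w(2) R1(4)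
        by (simp add: dist_norm)
      then have "?w + (r2 / (2 * B)) *\<^sub>R ?d \<in> Q"
        using hull r2(2) F_subset by (auto simp: dist_commute)
      then have ms: "r2 / (2 * B) \<le> max_step Q ?w ?d"
        using le_max_step[OF compact_Q wQ d0] r2(1) B(1) by simp
      have "\<gamma> / B\<^sup>2 \<le> (G ?w \<bullet> ?d) / (norm ?d)\<^sup>2"
        using gd nd pos(1) d0 by (intro frac_le power_mono) auto
      then have "c * (\<gamma> / B\<^sup>2) \<le> c * ((G ?w \<bullet> ?d) / (norm ?d)\<^sup>2)"
        using c by (intro mult_left_mono) auto
      then have "\<tau> \<le> step_bound f Q c ?w ?d"
        using ms unfolding \<tau>_def step_bound_def gradient_f by (rule min.mono[rotated])
      then have "\<rho> * \<tau> * \<gamma> \<le> \<rho> * step_bound f Q c ?w ?d * (G ?w \<bullet> ?d)"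
        using gd pos \<rho> by (intro mult_mono) auto
      also have "\<dots> \<le> f (z (Suc k)) - f ?w"
        using S2 ns fdfw_sequence_Suc[OF z(1) ns] by (simp add: stepsize_S2_def gradient_f)
      finally show ?thesis by simp
    qed
    have grow: "f (z k0) + real n * (\<rho> * \<tau> * \<gamma>) \<le> f (z (k0 + n))" for n
    proof (induction n)
      case (Suc n)
      then show ?case using gain[of "k0 + n"] by (simp add: algebra_simps)
    qed simp
    \<comment> \<open>A fixed gain per step would eventually exceed the upper bound
      \<open>f p\<close> on \<open>F\<close>.\<close>
    obtain n :: nat where "f p - f (z k0) < real n * (\<rho> * \<tau> * \<gamma>)"
      using reals_Archimedean3[of "\<rho> * \<tau> * \<gamma>"] pos \<rho> by auto
    moreover have "f (z (k0 + n)) \<le> f p"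
      using f_on_F tail[of "k0 + n"] mu_pos by simp
    ultimately show False using grow[of n] by simp
  qed
  show thesis by (rule that[OF R1(1,2)]) (fact tail, fact conv)
qed

text \<open>\<open>enters_F\<close> leads the run into \<open>F\<close> within \<open>R1\<close> of
  \<open>p\<close>, where \<open>tail_in_F\<close> takes over. The ambient dimension bounds that of
  every minimal face, so one radius serves all runs.\<close>

theorem fdfw_local_identification:
  assumes "0 < c" "0 < R"
  obtains U where "open U" "p \<in> U"
    "\<And>z d a kbar k. fdfw_sequence f Q z d a \<Longrightarrow> stepsize_S1 f Q c z d a \<Longrightarrow> incseq (\<lambda>k. f (z k))
      \<Longrightarrow> z kbar \<in> U \<Longrightarrow> int kbar + aff_dim (minimal_face Q (z kbar)) \<le> int k
      \<Longrightarrow> z k \<in> F \<and> dist (z k) p < R"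
    "\<And>z d a kbar \<rho>. fdfw_sequence f Q z d a \<Longrightarrow> stepsize_S1 f Q c z d a \<Longrightarrow> incseq (\<lambda>k. f (z k))
      \<Longrightarrow> z kbar \<in> U \<Longrightarrow> 0 < \<rho> \<Longrightarrow> stepsize_S2 f Q c \<rho> z d a \<Longrightarrow> z \<longlonglongrightarrow> p"
proof -
  obtain R1 where R1: "0 < R1" "R1 \<le> R"
    "\<And>z d a k0 k. fdfw_sequence f Q z d a \<Longrightarrow> incseq (\<lambda>k. f (z k)) \<Longrightarrow> z k0 \<in> F \<Longrightarrow> dist (z k0) p < R1
      \<Longrightarrow> k0 \<le> k \<Longrightarrow> z k \<in> F \<and> dist (z k) p < R1"
    "\<And>z d a k0 c \<rho>. fdfw_sequence f Q z d a \<Longrightarrow> incseq (\<lambda>k. f (z k)) \<Longrightarrow> z k0 \<in> F \<Longrightarrow> dist (z k0) p < R1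
      \<Longrightarrow> 0 < c \<Longrightarrow> 0 < \<rho> \<Longrightarrow> stepsize_S2 f Q c \<rho> z d a \<Longrightarrow> z \<longlonglongrightarrow> p"
    using tail_in_F[OF assms(2)] by blast
  obtain r where r: "0 < r" "\<And>z d a. fdfw_sequence f Q z d a \<Longrightarrow> stepsize_S1 f Q c z d a \<Longrightarrow> dist (z 0) p < r
    \<Longrightarrow> aff_dim (minimal_face Q (z 0)) \<le> int DIM('a)
    \<Longrightarrow> \<exists>i. int i \<le> aff_dim (minimal_face Q (z 0)) \<and> z i \<in> F \<and> dist (z i) p < R1"
    using enters_F[OF assms(1) R1(1), of "DIM('a)"] by blast
  have enter: "\<exists>i. int i \<le> aff_dim (minimal_face Q (z kbar)) \<and> z (kbar + i) \<in> F \<and> dist (z (kbar + i)) p < R1"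
    if "fdfw_sequence f Q z d a" "stepsize_S1 f Q c z d a" "z kbar \<in> ball p r" for z d a kbar
    using r(2)[OF fdfw_sequence_shift[OF that(1) compact_Q convex_Q, of kbar]
        stepsize_S1_shift[OF that(2), of kbar]] that(3) aff_dim_le_DIM[of "minimal_face Q (z kbar)"]
    by (simp add: dist_commute add.commute)
  show thesis
  proof (rule that[of "ball p r"])
    fix z d a kbar k
    assume z: "fdfw_sequence f Q z d a" "stepsize_S1 f Q c z d a" "incseq (\<lambda>k. f (z k))"
      "z kbar \<in> ball p r" "int kbar + aff_dim (minimal_face Q (z kbar)) \<le> int k"
    then obtain i where i: "int i \<le> aff_dim (minimal_face Q (z kbar))"
      "z (kbar + i) \<in> F" "dist (z (kbar + i)) p < R1"
      using enter by blast
    then show "z k \<in> F \<and> dist (z k) p < R"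
      using R1(3)[OF z(1,3) i(2,3), of k] R1(2) z(5) by auto
  next
    fix z d a kbar \<rho>
    assume z: "fdfw_sequence f Q z d a" "stepsize_S1 f Q c z d a" "incseq (\<lambda>k. f (z k))"
      "z kbar \<in> ball p r" "0 < (\<rho>::real)" "stepsize_S2 f Q c \<rho> z d a"
    then show "z \<longlonglongrightarrow> p" using enter[OF z(1,2,4)] R1(4)[OF z(1,3) _ _ assms(1) z(5,6)] by blast
  qed (use r in auto)
qed

end

section \<open>The feasible set and the derivative of the objective\<close>

lemma polytope_std_simplex: "polytope (std_simplex :: (real ^ 'n::finite) set)"
proof -
  have one: "1 \<bullet> x = (\<Sum>i\<in>UNIV. x $ i)" for x :: "real ^ 'n" by (simp add: inner_vec_def)
  have "std_simplex = (\<Inter>i. {x :: real ^ 'n. axis i 1 \<bullet> x \<ge> 0}) \<inter> {x. 1 \<bullet> x = 1}"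
    by (auto simp: std_simplex_def inner_axis' one)
  also have "polyhedron \<dots>"
    by (intro polyhedron_Int polyhedron_Inter polyhedron_hyperplane)
       (auto simp: polyhedron_halfspace_ge)
  finally have "polyhedron (std_simplex :: (real ^ 'n) set)" .
  moreover have "bounded (std_simplex :: (real ^ 'n) set)"
  proof (rule boundedI)
    fix x :: "real ^ 'n" assume "x \<in> std_simplex"
    then show "norm x \<le> 1" using norm_le_l1_cart[of x] by (simp add: std_simplex_def)
  qed
  ultimately show ?thesis by (simp add: polytope_eq_bounded_polyhedron)
qed

lemma polytope_D': "polytope (D'_set E s)"
proof -
  have sum: "(\<chi> e. if e \<in> co_edges E then 1 else 0) \<bullet> y = (\<Sum>e\<in>co_edges E. y $ e)" for y :: "real ^ ('a set)"
    by (simp add: inner_vec_def if_distrib[of "\<lambda>x. x * _"] sum.If_cases cong: if_cong)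
  have "D'_set E s = (\<Inter>e\<in>- co_edges E. {y. axis e 1 \<bullet> y = 0})
      \<inter> ((\<Inter>e\<in>co_edges E. {y. axis e 1 \<bullet> y \<ge> 0} \<inter> {y. axis e 1 \<bullet> y \<le> 1})
      \<inter> {y. (\<chi> e. if e \<in> co_edges E then 1 else 0) \<bullet> y \<le> real s})"
    unfolding sum by (auto simp: D'_set_def inner_axis')
  also have "polyhedron \<dots>"
    by (intro polyhedron_Int polyhedron_Inter polyhedron_halfspace_le)
       (auto intro!: polyhedron_Int simp: polyhedron_halfspace_ge polyhedron_halfspace_le polyhedron_hyperplane)
  finally have "polyhedron (D'_set E s)" .
  moreover have "bounded (D'_set E s)"
  proof (rule boundedI)
    fix y assume y: "y \<in> D'_set E s"
    have "\<bar>y $ e\<bar> \<le> 1" for e using y by (cases "e \<in> co_edges E") (auto simp: D'_set_def)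
    then have "(\<Sum>e\<in>UNIV. \<bar>y $ e\<bar>) \<le> (\<Sum>e\<in>(UNIV :: 'a set set). 1)" by (intro sum_mono)
    then show "norm y \<le> (\<Sum>e\<in>(UNIV :: 'a set set). 1)" using norm_le_l1_cart[of y] by linarith
  qed
  ultimately show ?thesis by (simp add: polytope_eq_bounded_polyhedron)
qed

lemma polytope_P_set: "polytope (P_set E s)"
  by (simp add: P_set_def polytope_Times polytope_std_simplex polytope_D')

section \<open>The bilinear form of the graph matrix and the gradient of the objective\<close>

definition edge_form :: "'n::finite set set \<Rightarrow> real ^ ('n set) \<Rightarrow> real ^ 'n \<Rightarrow> real ^ 'n \<Rightarrow> real" where
  "edge_form E y u v = (\<Sum>i\<in>UNIV. \<Sum>j\<in>UNIV. (adj_matrix E $ i $ j + co_matrix E y $ i $ j) * (u $ i * v $ j))"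

text \<open>The derivative of \<open>edge_form\<close> in direction \<open>l\<close> of
  \<open>y\<close> at \<open>u = v = x\<close>; the dependence on \<open>y\<close> is
  affine.\<close>

definition co_form :: "'n::finite set set \<Rightarrow> real ^ ('n set) \<Rightarrow> real ^ 'n \<Rightarrow> real" where
  "co_form E l x = (\<Sum>i\<in>UNIV. \<Sum>j\<in>UNIV. co_matrix E l $ i $ j * (x $ i * x $ j))"

lemma edge_form_sym: "edge_form E y u v = edge_form E y v u"
proof -
  have "adj_matrix E $ i $ j + co_matrix E y $ i $ j = adj_matrix E $ j $ i + co_matrix E y $ j $ i" for i j
    by (simp add: adj_matrix_def co_matrix_def insert_commute)
  then show ?thesis
    unfolding edge_form_def by (subst sum.swap) (simp add: mult.commute)
qed

lemma edge_form_add: "edge_form E y (u + v) w = edge_form E y u w + edge_form E y v w"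
  and edge_form_scaleR: "edge_form E y (t *\<^sub>R u) w = t * edge_form E y u w"
  by (simp_all add: edge_form_def sum.distrib sum_distrib_left algebra_simps)

lemma edge_form_line:
  "edge_form E y (x + t *\<^sub>R u) (x + t *\<^sub>R u)
    = edge_form E y x x + 2 * t * edge_form E y u x + t\<^sup>2 * edge_form E y u u"
proof -
  have "edge_form E y (x + t *\<^sub>R u) (x + t *\<^sub>R u)
    = edge_form E y (x + t *\<^sub>R u) x + t * edge_form E y (x + t *\<^sub>R u) u"
    by (simp add: edge_form_add edge_form_scaleR edge_form_sym[of E y _ "x + t *\<^sub>R u"])
  then show ?thesis
    by (simp add: edge_form_add edge_form_scaleR edge_form_sym[of E y x u] power2_eq_square algebra_simps)
qed

lemma edge_form_y_line:
  "edge_form E (y + t *\<^sub>R l) x x = edge_form E y x x + t * co_form E l x"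
proof -
  have "co_matrix E (y + t *\<^sub>R l) $ i $ j = co_matrix E y $ i $ j + t * co_matrix E l $ i $ j" for i j
    by (simp add: co_matrix_def)
  then show ?thesis
    by (simp add: edge_form_def co_form_def sum.distrib sum_distrib_left algebra_simps)
qed

lemma h_obj_eq:
  "h_obj E \<alpha> \<beta> w = edge_form E (snd w) (fst w) (fst w) + \<alpha> / 2 * (fst w \<bullet> fst w) + \<beta> / 2 * (snd w \<bullet> snd w)"
  by (simp add: h_obj_def edge_form_def case_prod_unfold power2_norm_eq_inner)
     (simp add: inner_vec_def matrix_vector_mult_def sum_distrib_left algebra_simps)

definition h_deriv ::
  "'n::finite set set \<Rightarrow> real \<Rightarrow> real \<Rightarrow> (real ^ 'n) \<times> (real ^ ('n set)) \<Rightarrow> (real ^ 'n) \<times> (real ^ ('n set)) \<Rightarrow> real" where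
  "h_deriv E \<alpha> \<beta> w u = 2 * edge_form E (snd w) (fst u) (fst w) + co_form E (snd u) (fst w)
     + \<alpha> * (fst u \<bullet> fst w) + \<beta> * (snd u \<bullet> snd w)"

text \<open>Product rule in each summand; the two contributions of the \<open>x\<close> factors
  agree by symmetry, whence the factor 2.\<close>

lemma has_derivative_h_obj: "(h_obj E \<alpha> \<beta> has_derivative h_deriv E \<alpha> \<beta> w) (at w)"
proof -
  let ?a = "\<lambda>y i j. adj_matrix E $ i $ j + co_matrix E y $ i $ j"
  have co: "((\<lambda>w. co_matrix E (snd w) $ i $ j) has_derivative (\<lambda>u. co_matrix E (snd u) $ i $ j)) (at w)"
    for w :: "(real ^ 'a) \<times> (real ^ ('a set))" and i j
    by (cases "{i, j} \<in> co_edges E")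
       (auto simp: co_matrix_def intro!: bounded_linear.has_derivative[OF bounded_linear_vec_nth] derivative_eq_intros)
  have nth: "((\<lambda>w. fst w $ i) has_derivative (\<lambda>u. fst u $ i)) (at w)"
    for w :: "(real ^ 'a) \<times> (real ^ ('a set))" and i
    by (auto intro!: bounded_linear.has_derivative[OF bounded_linear_vec_nth] derivative_eq_intros)
  have "((\<lambda>w. edge_form E (snd w) (fst w) (fst w)) has_derivative
     (\<lambda>u. \<Sum>i\<in>UNIV. \<Sum>j\<in>UNIV. ?a (snd w) i j * (fst w $ i * fst u $ j + fst u $ i * fst w $ j)
        + co_matrix E (snd u) $ i $ j * (fst w $ i * fst w $ j))) (at w)"
    unfolding edge_form_def
    by (rule derivative_eq_intros co nth refl | simp)+
  moreover have "(\<Sum>i\<in>UNIV. \<Sum>j\<in>UNIV. ?a (snd w) i j * (fst w $ i * fst u $ j + fst u $ i * fst w $ j)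
        + co_matrix E (snd u) $ i $ j * (fst w $ i * fst w $ j))
     = 2 * edge_form E (snd w) (fst u) (fst w) + co_form E (snd u) (fst w)" for u
  proof -
    have "(\<Sum>i\<in>UNIV. \<Sum>j\<in>UNIV. ?a (snd w) i j * (fst w $ i * fst u $ j + fst u $ i * fst w $ j)
        + co_matrix E (snd u) $ i $ j * (fst w $ i * fst w $ j))
      = edge_form E (snd w) (fst w) (fst u) + edge_form E (snd w) (fst u) (fst w) + co_form E (snd u) (fst w)"
      by (simp add: edge_form_def co_form_def sum.distrib distrib_left)
    then show ?thesis by (simp add: edge_form_sym[of E "snd w" "fst w"])
  qed
  ultimately have form: "((\<lambda>w. edge_form E (snd w) (fst w) (fst w)) has_derivative
     (\<lambda>u. 2 * edge_form E (snd w) (fst u) (fst w) + co_form E (snd u) (fst w))) (at w)"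
    by simp
  show ?thesis
    unfolding h_obj_eq[abs_def] h_deriv_def[abs_def]
    by (rule derivative_eq_intros form refl | simp add: inner_commute algebra_simps)+
qed

text \<open>The Riesz representative of the derivative, obtained as the adjoint of a linear
  functional evaluated at 1.\<close>

definition h_grad ::
  "'n::finite set set \<Rightarrow> real \<Rightarrow> real \<Rightarrow> (real ^ 'n) \<times> (real ^ ('n set)) \<Rightarrow> (real ^ 'n) \<times> (real ^ ('n set))" where
  "h_grad E \<alpha> \<beta> w = adjoint (h_deriv E \<alpha> \<beta> w) 1"

lemma inner_h_grad: "u \<bullet> h_grad E \<alpha> \<beta> w = h_deriv E \<alpha> \<beta> w u"
  using adjoint_works[OF has_derivative_linear[OF has_derivative_h_obj], of u E \<alpha> \<beta> w 1]
  by (simp add: h_grad_def)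

lemma GDERIV_h_obj: "GDERIV (h_obj E \<alpha> \<beta>) w :> h_grad E \<alpha> \<beta> w"
  unfolding gderiv_def inner_h_grad by (rule has_derivative_h_obj)

text \<open>Each component is the derivative in a fixed basis direction, which is polynomial in
  \<open>w\<close>.\<close>

lemma isCont_h_grad: "isCont (h_grad E \<alpha> \<beta>) w"
proof -
  have co: "((\<lambda>w. co_matrix E (snd w) $ i $ j) \<longlongrightarrow> co_matrix E (snd w) $ i $ j) (at w)" for i j
    by (cases "{i, j} \<in> co_edges E") (auto simp: co_matrix_def intro!: tendsto_intros)
  show ?thesis
    unfolding isCont_def tendsto_componentwise_iff[of "h_grad E \<alpha> \<beta>"]
      inner_commute[of "h_grad E \<alpha> \<beta> _"] inner_h_grad h_deriv_def edge_form_def co_form_def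
    by (intro ballI tendsto_intros co)
qed

section \<open>Characteristic vectors\<close>

lemma char_vec_nth: "char_vec C $ i = (if i \<in> C then 1 / real (card C) else 0)"
proof -
  have "(\<Sum>k\<in>C. axis k (1::real)) $ i = (\<Sum>k\<in>C. if k = i then 1 else 0)"
    unfolding sum_component by (intro sum.cong) (auto simp: axis_def)
  then show ?thesis by (simp add: char_vec_def)
qed

lemma sum_char_vec: "(\<Sum>i\<in>UNIV. char_vec C $ i * f i) = (\<Sum>i\<in>C. f i) / real (card C)"
  by (simp add: char_vec_nth if_distrib[of "\<lambda>x. x * _"] sum.If_cases sum_divide_distrib cong: if_cong)

lemma char_vec_mem_simplex: "C \<noteq> {} \<Longrightarrow> char_vec C \<in> std_simplex"
  using sum_char_vec[of C "\<lambda>_. 1"] by (auto simp: std_simplex_def char_vec_nth)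

section \<open>Strict local maximizers of the objective\<close>

text \<open>Only the shape of the \<open>x\<close> part is presupposed; that \<open>yp\<close> is
  binary and \<open>C\<close> a maximal clique is derived from strictness.\<close>

locale strict_local_maximizer =
  fixes E :: "'n::finite set set" and s :: nat and \<alpha> \<beta> :: real
    and C :: "'n set" and yp :: "real ^ ('n set)"
  assumes simple_graph: "simple_graph E"
    and s_le: "s \<le> card (co_edges E)"
    and alpha: "0 < \<alpha>" "\<alpha> < 2" and beta: "0 < \<beta>"
    and C_nonempty: "C \<noteq> {}"
    and maximizer: "(char_vec C, yp) \<in> M_set E s \<alpha> \<beta>"
begin

abbreviation "xC \<equiv> char_vec C"
abbreviation "p \<equiv> (char_vec C, yp)"
abbreviation "h \<equiv> h_obj E \<alpha> \<beta>"
abbreviation "P \<equiv> P_set E s"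
abbreviation "m \<equiv> real (card C)"

text \<open>Once \<open>yp\<close> is known to be binary, this is the adjacency matrix of the graph
  \<open>G(yp)\<close>.\<close>

definition "A i j = adj_matrix E $ i $ j + co_matrix E yp $ i $ j"

lemma m_pos: "0 < m" using C_nonempty by (simp add: card_gt_0_iff)

lemma p_mem: "p \<in> P"
  using maximizer by (simp add: M_set_def strict_local_maximizers_def)

lemma yp_mem: "yp \<in> D'_set E s" using p_mem by (simp add: P_set_def)

section \<open>Feasible lines through the maximizer, and the shape of \<open>yp\<close>\<close>

lemma strict_along_line:
  assumes "d \<noteq> 0"
  shows "\<exists>\<epsilon>>0. \<forall>t. t \<noteq> 0 \<longrightarrow> \<bar>t\<bar> < \<epsilon> \<longrightarrow> p + t *\<^sub>R d \<in> P \<longrightarrow> h (p + t *\<^sub>R d) < h p"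
proof -
  obtain W where W: "open W" "p \<in> W" "\<And>q. q \<in> P \<Longrightarrow> q \<in> W \<Longrightarrow> q \<noteq> p \<Longrightarrow> h q < h p"
    using maximizer by (auto simp: M_set_def strict_local_maximizers_def)
  obtain e where e: "0 < e" "ball p e \<subseteq> W" using W(1,2) open_contains_ball by blast
  show ?thesis
  proof (intro exI[of _ "e / norm d"] conjI allI impI)
    show "0 < e / norm d" using e(1) assms by simp
    fix t assume t: "t \<noteq> 0" "\<bar>t\<bar> < e / norm d" "p + t *\<^sub>R d \<in> P"
    have "dist p (p + t *\<^sub>R d) = \<bar>t\<bar> * norm d" by (simp add: dist_norm del: add_Pair)
    also have "\<dots> < e" using t(2) assms by (simp add: field_simps)
    finally have "p + t *\<^sub>R d \<in> W" using e(2) by auto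
    moreover have "p + t *\<^sub>R d \<noteq> p" using t(1) assms by simp
    ultimately show "h (p + t *\<^sub>R d) < h p" using W(3) t(3) by blast
  qed
qed

lemma no_ascent_line:
  assumes "d \<noteq> 0" "0 < r" "\<And>t. 0 < t \<Longrightarrow> t \<le> r \<Longrightarrow> p + t *\<^sub>R d \<in> P"
    "\<And>t. 0 < t \<Longrightarrow> t \<le> r \<Longrightarrow> h p \<le> h (p + t *\<^sub>R d)"
  shows False
proof -
  obtain \<epsilon> where \<epsilon>: "0 < \<epsilon>" "\<And>t. t \<noteq> 0 \<Longrightarrow> \<bar>t\<bar> < \<epsilon> \<Longrightarrow> p + t *\<^sub>R d \<in> P \<Longrightarrow> h (p + t *\<^sub>R d) < h p"
    using strict_along_line[OF assms(1)] by blast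
  define t where "t = min r (\<epsilon> / 2)"
  have "0 < t" "t \<le> r" "t < \<epsilon>" using \<epsilon>(1) assms(2) by (auto simp: t_def)
  then show False using \<epsilon>(2)[of t] assms(3,4)[of t] by simp
qed

text \<open>If the average over \<open>t\<close> and \<open>- t\<close> is at least
  \<open>h p\<close>, the two values cannot both be smaller than \<open>h p\<close>.\<close>

lemma no_convex_line:
  assumes "d \<noteq> 0" "0 < r" "\<And>t. \<bar>t\<bar> \<le> r \<Longrightarrow> p + t *\<^sub>R d \<in> P"
    "\<And>t. \<bar>t\<bar> \<le> r \<Longrightarrow> 2 * h p \<le> h (p + t *\<^sub>R d) + h (p + (- t) *\<^sub>R d)"
  shows False
proof -
  obtain \<epsilon> where \<epsilon>: "0 < \<epsilon>" "\<And>t. t \<noteq> 0 \<Longrightarrow> \<bar>t\<bar> < \<epsilon> \<Longrightarrow> p + t *\<^sub>R d \<in> P \<Longrightarrow> h (p + t *\<^sub>R d) < h p"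
    using strict_along_line[OF assms(1)] by blast
  define t where "t = min r (\<epsilon> / 2)"
  have t: "0 < t" "t \<le> r" "t < \<epsilon>" using \<epsilon>(1) assms(2) by (auto simp: t_def)
  have "h (p + t *\<^sub>R d) < h p" "h (p + (- t) *\<^sub>R d) < h p"
    using t by (auto intro!: \<epsilon>(2) assms(3) simp del: scaleR_minus_left add_Pair)
  then show False using assms(4)[of t] t by (simp del: scaleR_minus_left)
qed

lemma h_y_line:
  "h (xC, yp + t *\<^sub>R l) = h p + t * (co_form E l xC + \<beta> * (yp \<bullet> l)) + \<beta> / 2 * t\<^sup>2 * (l \<bullet> l)"
  by (simp add: h_obj_eq edge_form_y_line inner_add_left inner_add_right inner_commute[of l yp]
      power2_eq_square algebra_simps)

lemma h_x_line:
  "h (xC + t *\<^sub>R k, yp) = h p + t * (2 * edge_form E yp k xC + \<alpha> * (k \<bullet> xC))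
     + t\<^sup>2 * (edge_form E yp k k + \<alpha> / 2 * (k \<bullet> k))"
  by (simp add: h_obj_eq edge_form_line inner_add_left inner_add_right inner_commute[of xC k]
      power2_eq_square algebra_simps)

text \<open>With budget left over, some coordinate can be raised, and this does not decrease
  \<open>h\<close> since all its terms in \<open>y\<close> have nonnegative coefficients.\<close>

lemma sum_yp: "(\<Sum>e\<in>co_edges E. yp $ e) = real s"
proof (rule ccontr)
  let ?S = "\<Sum>e\<in>co_edges E. yp $ e"
  assume "?S \<noteq> real s"
  then have less: "?S < real s" using yp_mem by (simp add: D'_set_def)
  \<comment> \<open>If all coordinates were 1, the sum would already reach the number of non-edges,
    which is at least \<open>s\<close>.\<close>
  have "\<exists>e\<in>co_edges E. yp $ e < 1"
  proof (rule ccontr)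
    assume "\<not> ?thesis"
    then have "(\<Sum>e\<in>co_edges E. 1) \<le> ?S" by (intro sum_mono) auto
    then show False using less s_le by simp
  qed
  then obtain e where e: "e \<in> co_edges E" "yp $ e < 1" by blast
  let ?l = "axis e 1 :: real ^ ('n set)"
  let ?r = "min (1 - yp $ e) (real s - ?S)"
  show False
  proof (rule no_ascent_line[of "(0, ?l)" ?r])
    fix t assume t: "0 < t" "t \<le> ?r"
    define y where "y = yp + t *\<^sub>R ?l"
    have nth: "y $ e' = yp $ e' + (if e' = e then t else 0)" for e' by (simp add: y_def axis_def)
    have "(\<Sum>e'\<in>co_edges E. y $ e') = ?S + t"
      unfolding nth using e(1) by (simp add: sum.distrib)
    then have "y \<in> D'_set E s"
      using yp_mem t e unfolding D'_set_def by (auto simp: nth add_nonneg_nonneg)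
    then show "p + t *\<^sub>R (0, ?l) \<in> P" using p_mem by (simp add: P_set_def y_def)
    have "0 \<le> co_form E ?l xC"
      unfolding co_form_def by (intro sum_nonneg) (simp add: co_matrix_def axis_def char_vec_nth)
    moreover have "0 \<le> yp \<bullet> ?l" using yp_mem e(1) by (simp add: inner_axis D'_set_def)
    ultimately have "0 \<le> t * (co_form E ?l xC + \<beta> * (yp \<bullet> ?l)) + \<beta> / 2 * t\<^sup>2 * (?l \<bullet> ?l)"
      using t beta by (intro add_nonneg_nonneg mult_nonneg_nonneg) auto
    then show "h p \<le> h (p + t *\<^sub>R (0, ?l))" by (simp add: h_y_line)
  qed (use e less in \<open>auto simp: zero_prod_def axis_eq_0_iff\<close>)
qed

text \<open>The coordinates sum to the integer \<open>s\<close>, so a fractional one has a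
  fractional partner. Shifting weight between them keeps the sum, and the \<open>\<beta>\<close>
  term makes \<open>h\<close> convex along this line.\<close>

lemma yp_binary:
  assumes "e \<in> co_edges E"
  shows "yp $ e = 0 \<or> yp $ e = 1"
proof (rule ccontr)
  assume "\<not> ?thesis"
  then have e: "0 < yp $ e" "yp $ e < 1" using yp_mem assms by (force simp: D'_set_def)+
  have "\<exists>e'\<in>co_edges E - {e}. yp $ e' \<noteq> 0 \<and> yp $ e' \<noteq> 1"
  proof (rule ccontr)
    assume "\<not> ?thesis"
    then have "yp $ e' \<in> \<int>" if "e' \<in> co_edges E - {e}" for e' using that by (cases "yp $ e' = 0") auto
    then have "(\<Sum>e'\<in>co_edges E - {e}. yp $ e') \<in> \<int>" by (intro Ints_sum)
    moreover have "yp $ e = real s - (\<Sum>e'\<in>co_edges E - {e}. yp $ e')"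
      using sum_yp sum.remove[OF _ assms, of "($) yp"] by simp
    ultimately have "yp $ e \<in> \<int>" by simp
    then show False using e by (auto elim!: Ints_cases)
  qed
  then obtain e' where e': "e' \<in> co_edges E" "e' \<noteq> e" "0 < yp $ e'" "yp $ e' < 1"
    using yp_mem by (force simp: D'_set_def)
  let ?l = "axis e 1 - axis e' 1 :: real ^ ('n set)"
  let ?r = "min (min (yp $ e) (1 - yp $ e)) (min (yp $ e') (1 - yp $ e'))"
  show False
  proof (rule no_convex_line[of "(0, ?l)" ?r])
    have "?l $ e = 1" using e' by (simp add: axis_def)
    then have "?l \<noteq> 0" by (metis zero_index zero_neq_one)
    then show "(0, ?l) \<noteq> 0" by (simp add: zero_prod_def)
  next
    fix t assume t: "\<bar>t\<bar> \<le> ?r"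
    define y where "y = yp + t *\<^sub>R ?l"
    have nth: "y $ k = yp $ k + ((if k = e then t else 0) + (if k = e' then - t else 0))" for k
      using e' by (simp add: y_def axis_def)
    have "(\<Sum>k\<in>co_edges E. y $ k) = real s"
      unfolding nth using assms e'(1) sum_yp by (simp add: sum.distrib)
    then have "y \<in> D'_set E s"
      using yp_mem t e e'(1,3,4) assms unfolding D'_set_def by (auto simp: nth abs_le_iff)
    then show "p + t *\<^sub>R (0, ?l) \<in> P" using p_mem by (simp add: P_set_def y_def)
    have "h (xC, yp + t *\<^sub>R ?l) + h (xC, yp + (- t) *\<^sub>R ?l) = 2 * h p + \<beta> * t\<^sup>2 * (?l \<bullet> ?l)"
      unfolding h_y_line by (simp add: algebra_simps)
    moreover have "0 \<le> \<beta> * t\<^sup>2 * (?l \<bullet> ?l)" using beta by (intro mult_nonneg_nonneg) auto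
    ultimately show "2 * h p \<le> h (p + t *\<^sub>R (0, ?l)) + h (p + (- t) *\<^sub>R (0, ?l))" by simp
  qed (use e e' in auto)
qed

section \<open>The graph of \<open>yp\<close> and the clique \<open>C\<close>\<close>

lemma A_diag: "A i i = 0" and A_binary: "A i j = 0 \<or> A i j = 1" and A_sym: "A i j = A j i"
proof -
  have "{i} \<notin> all_pairs" for i :: 'n by (simp add: all_pairs_def)
  then show "A i i = 0"
    using simple_graph by (auto simp: A_def adj_matrix_def co_matrix_def co_edges_def simple_graph_def)
  show "A i j = 0 \<or> A i j = 1"
    using yp_binary[of "{i, j}"] by (auto simp: A_def adj_matrix_def co_matrix_def co_edges_def)
  show "A i j = A j i" by (simp add: A_def adj_matrix_def co_matrix_def insert_commute)
qed

lemma edge_form_yp: "edge_form E yp u v = (\<Sum>i\<in>UNIV. \<Sum>j\<in>UNIV. A i j * (u $ i * v $ j))"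
  by (simp add: edge_form_def A_def)

lemma edge_form_xC: "edge_form E yp u xC = (\<Sum>i\<in>UNIV. u $ i * ((\<Sum>j\<in>C. A i j) / m))"
  unfolding edge_form_yp sum_char_vec[of C "A _", symmetric]
  by (simp add: sum_distrib_left mult_ac)

text \<open>Shifting weight between nonadjacent \<open>i\<close> and \<open>j\<close> changes the
  graph form only to first order, and the \<open>\<alpha>\<close> term makes \<open>h\<close> convex
  along the line.\<close>

lemma clique:
  assumes "i \<in> C" "j \<in> C" "i \<noteq> j"
  shows "A i j = 1"
proof (rule ccontr)
  assume "A i j \<noteq> 1"
  then have Aij: "A i j = 0" using A_binary by blast
  let ?k = "axis i 1 - axis j 1 :: real ^ 'n"
  show False
  proof (rule no_convex_line[of "(?k, 0)" "1 / m"])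
    have "?k $ i = 1" using assms by (simp add: axis_def)
    then have "?k \<noteq> 0" by (metis zero_index zero_neq_one)
    then show "(?k, 0) \<noteq> 0" by (simp add: zero_prod_def)
  next
    fix t assume t: "\<bar>t\<bar> \<le> 1 / m"
    define x where "x = xC + t *\<^sub>R ?k"
    have nth: "x $ v = xC $ v + ((if v = i then t else 0) + (if v = j then - t else 0))" for v
      using assms by (simp add: x_def axis_def)
    have "(\<Sum>v\<in>UNIV. x $ v) = 1"
      unfolding nth using char_vec_mem_simplex[OF C_nonempty] by (simp add: sum.distrib std_simplex_def)
    then have "x \<in> std_simplex"
      using assms t unfolding std_simplex_def by (auto simp: nth char_vec_nth abs_le_iff)
    then show "p + t *\<^sub>R (?k, 0) \<in> P" using p_mem by (simp add: P_set_def x_def)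
    \<comment> \<open>The value is \<open>A i i + A j j - 2 A i j\<close>.\<close>
    have "edge_form E yp ?k ?k = 0"
    proof -
      have ax: "edge_form E yp (axis a 1) (axis b 1) = A a b" for a b
      proof -
        have "edge_form E yp (axis a 1) (axis b 1)
          = (\<Sum>i\<in>UNIV. \<Sum>j\<in>UNIV. if j = b then if i = a then A a b else 0 else 0)"
          unfolding edge_form_yp by (intro sum.cong refl) (simp add: axis_def)
        then show ?thesis by simp
      qed
      have diff: "edge_form E yp (u - v) w = edge_form E yp u w - edge_form E yp v w" for u v w
        using edge_form_add[of E yp u "(- 1) *\<^sub>R v" w] edge_form_scaleR[of E yp "- 1" v w] by simp
      have diff': "edge_form E yp w (u - v) = edge_form E yp w u - edge_form E yp w v" for u v w
        using diff[of u v w] by (simp add: edge_form_sym[of E yp w])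
      show ?thesis
        unfolding diff diff' ax by (simp add: A_diag Aij A_sym[of j i])
    qed
    then have "h (xC + t *\<^sub>R ?k, yp) + h (xC + (- t) *\<^sub>R ?k, yp) = 2 * h p + \<alpha> * t\<^sup>2 * (?k \<bullet> ?k)"
      unfolding h_x_line by (simp add: algebra_simps)
    moreover have "0 \<le> \<alpha> * t\<^sup>2 * (?k \<bullet> ?k)" using alpha by (intro mult_nonneg_nonneg) auto
    ultimately show "2 * h p \<le> h (p + t *\<^sub>R (?k, 0)) + h (p + (- t) *\<^sub>R (?k, 0))" by simp
  qed (use m_pos in auto)
qed

section \<open>First-order conditions at the maximizer\<close>

lemma degree_in_C:
  assumes "i \<in> C"
  shows "(\<Sum>j\<in>C. A i j) = m - 1"
proof -
  have "(\<Sum>j\<in>C. A i j) = (\<Sum>j\<in>C. if j = i then 0 else 1)"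
    using clique[OF assms] A_diag by (intro sum.cong) auto
  also have "\<dots> = (\<Sum>j\<in>C. 1 - (if j = i then 1 else 0))" by (intro sum.cong) auto
  also have "\<dots> = m - 1" using assms by (simp add: sum_subtractf)
  finally show ?thesis .
qed

text \<open>The \<open>x\<close>-part of the gradient of the objective at \<open>p\<close>, and its common value on \<open>C\<close>.\<close>

definition "gx i = 2 * ((\<Sum>j\<in>C. A i j) / m) + \<alpha> * xC $ i"

definition "gC = (2 * (m - 1) + \<alpha>) / m"

lemma gx_in_C: "i \<in> C \<Longrightarrow> gx i = gC"
  by (simp add: gx_def gC_def degree_in_C char_vec_nth add_divide_distrib)

lemma edge_form_gx: "2 * edge_form E yp u xC + \<alpha> * (u \<bullet> xC) = (\<Sum>i\<in>UNIV. u $ i * gx i)"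
  unfolding edge_form_xC
  by (simp add: gx_def inner_vec_def sum.distrib[symmetric] sum_distrib_left algebra_simps)

lemma sum_xC_gx: "(\<Sum>i\<in>UNIV. xC $ i * gx i) = gC"
  unfolding sum_char_vec using m_pos by (simp add: gx_in_C C_nonempty)

text \<open>First-order optimality alone gives \<open>gx i \<le> gC\<close>. Since
  \<open>gx i\<close> is \<open>2 / m\<close> times the number of neighbors of \<open>i\<close> in
  \<open>C\<close>, integrality improves this to a strict gap.\<close>

lemma gx_not_in_C:
  assumes "i \<notin> C"
  shows "gx i \<le> gC - \<alpha> / m"
proof -
  define n where "n = card {j\<in>C. A i j = 1}"
  have "(\<Sum>j\<in>C. A i j) = (\<Sum>j\<in>C. if A i j = 1 then 1 else 0)"
    by (intro sum.cong) (use A_binary[of i] in auto)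
  then have deg: "(\<Sum>j\<in>C. A i j) = real n" by (simp add: n_def sum.If_cases Int_def)
  then have gx: "gx i = 2 * real n / m" using assms by (simp add: gx_def char_vec_nth)
  have "gx i \<le> gC"
  proof (rule ccontr)
    assume "\<not> gx i \<le> gC"
    let ?k = "axis i 1 - xC"
    have slope: "2 * edge_form E yp ?k xC + \<alpha> * (?k \<bullet> xC) = gx i - gC"
    proof -
      have "(\<Sum>v\<in>UNIV. ?k $ v * gx v) = (\<Sum>v\<in>UNIV. axis i 1 $ v * gx v) - gC"
        using sum_xC_gx by (simp add: sum_subtractf left_diff_distrib)
      also have "(\<Sum>v\<in>UNIV. axis i 1 $ v * gx v) = gx i"
        by (simp add: axis_def if_distrib[of "\<lambda>x. x * _"] cong: if_cong)
      finally show ?thesis unfolding edge_form_gx .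
    qed
    \<comment> \<open>\<open>c\<close> dominates the quadratic coefficient, so for
      \<open>t \<le> r\<close> the linear gain prevails; \<open>r \<le> 1\<close> keeps the point in
      the simplex.\<close>
    define c where "c = \<bar>edge_form E yp ?k ?k + \<alpha> / 2 * (?k \<bullet> ?k)\<bar> + 1"
    define r where "r = min 1 ((gx i - gC) / c)"
    have "0 < c" by (simp add: c_def)
    have "0 < r" using \<open>0 < c\<close> \<open>\<not> gx i \<le> gC\<close> by (simp add: r_def)
    show False
    proof (rule no_ascent_line[of "(?k, 0)" r])
      have "?k $ i = 1" using assms by (simp add: axis_def char_vec_nth)
      then have "?k \<noteq> 0" by (metis zero_index zero_neq_one)
    then show "(?k, 0) \<noteq> 0" by (simp add: zero_prod_def)
    next
      fix t assume t: "0 < t" "t \<le> r"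
      have "axis i 1 \<in> std_simplex" by (auto simp: std_simplex_def axis_def)
      then have "(1 - t) *\<^sub>R xC + t *\<^sub>R axis i 1 \<in> std_simplex"
        using t polytope_std_simplex[THEN polytope_imp_convex] char_vec_mem_simplex[OF C_nonempty]
        by (intro convexD_alt) (auto simp: r_def)
      then show "p + t *\<^sub>R (?k, 0) \<in> P"
        using p_mem by (simp add: P_set_def algebra_simps)
      have "t * (- c) \<le> t * (edge_form E yp ?k ?k + \<alpha> / 2 * (?k \<bullet> ?k))"
        using t by (intro mult_left_mono) (auto simp: c_def)
      moreover have "t * c \<le> gx i - gC"
        using t \<open>0 < c\<close> by (auto simp: r_def field_simps)
      ultimately have "0 \<le> t * ((gx i - gC) + t * (edge_form E yp ?k ?k + \<alpha> / 2 * (?k \<bullet> ?k)))"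
        using t by (intro mult_nonneg_nonneg) auto
      moreover have "h (xC + t *\<^sub>R ?k, yp)
        = h p + t * ((gx i - gC) + t * (edge_form E yp ?k ?k + \<alpha> / 2 * (?k \<bullet> ?k)))"
        unfolding h_x_line slope power2_eq_square by (simp only: distrib_left mult.assoc add.assoc)
      ultimately show "h p \<le> h (p + t *\<^sub>R (?k, 0))" by simp
    qed fact
  qed
  \<comment> \<open>As \<open>\<alpha> < 2\<close>, this gives \<open>n < m\<close>, hence
    \<open>n \<le> m - 1\<close>: \<open>C\<close> is maximal, and the rounding frees
    \<open>\<alpha> / m\<close>.\<close>
  then have "2 * real n \<le> 2 * (m - 1) + \<alpha>"
    using m_pos by (simp add: gx gC_def divide_le_cancel)
  also have "2 * (m - 1) + \<alpha> < 2 * m" using alpha by simp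
  finally have "n + 1 \<le> card C" by simp
  then have "real (n + 1) \<le> m" by (simp only: of_nat_le_iff)
  then have "real n \<le> m - 1" by simp
  then have "2 * real n / m \<le> 2 * (m - 1) / m" using m_pos by (intro divide_right_mono) auto
  then show ?thesis by (simp add: gx gC_def add_divide_distrib)
qed

text \<open>Non-edges of the original graph inside \<open>C\<close> must have been added by
  \<open>yp\<close>, at the maximal value 1, so \<open>y\<close> can only be lower there.\<close>

lemma co_form_le:
  assumes "y \<in> D'_set E s"
  shows "co_form E (y - yp) xC \<le> 0"
  unfolding co_form_def
proof (intro sum_nonpos)
  fix i j
  show "co_matrix E (y - yp) $ i $ j * (xC $ i * xC $ j) \<le> 0"
  proof (cases "i \<in> C \<and> j \<in> C \<and> {i, j} \<in> co_edges E")
    case True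
    then have "i \<noteq> j" by (auto simp: co_edges_def all_pairs_def)
    then have "A i j = 1" using clique True by blast
    then have "yp $ {i, j} = 1"
      using True by (simp add: A_def adj_matrix_def co_matrix_def co_edges_def)
    then have "co_matrix E (y - yp) $ i $ j \<le> 0"
      using True assms by (simp add: co_matrix_def D'_set_def)
    then show ?thesis by (intro mult_nonpos_nonneg) (auto simp: char_vec_nth)
  next
    case False
    then show ?thesis by (auto simp: co_matrix_def char_vec_nth)
  qed
qed

text \<open>As \<open>yp\<close> is binary, the product measures how far \<open>y\<close> falls
  short on the added edges.\<close>

lemma inner_yp: "(y - yp) \<bullet> yp = - (\<Sum>e | e \<in> co_edges E \<and> yp $ e = 1. 1 - y $ e)"
proof -
  have "(y - yp) \<bullet> yp = (\<Sum>e\<in>UNIV. if e \<in> co_edges E \<and> yp $ e = 1 then - (1 - y $ e) else 0)"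
    unfolding inner_vec_def
  proof (intro sum.cong refl)
    fix e
    show "(y - yp) $ e \<bullet> yp $ e = (if e \<in> co_edges E \<and> yp $ e = 1 then - (1 - y $ e) else 0)"
      using yp_binary[of e] yp_mem by (cases "e \<in> co_edges E") (auto simp: D'_set_def)
  qed
  then show ?thesis by (simp add: sum.If_cases Collect_conj_eq flip: sum_negf)
qed

definition "F = {(x, y). x \<in> std_simplex \<and> (\<forall>i. i \<notin> C \<longrightarrow> x $ i = 0) \<and> y = yp}"

text \<open>The derivative is a sum of three nonpositive terms: the \<open>x\<close> mass off
  \<open>C\<close> with weights at most \<open>- \<alpha> / m\<close>, the \<open>co_form\<close>
  term, and \<open>- \<beta>\<close> times the shortfall of \<open>y\<close> on the added edges. It
  vanishes only if the first and the last do.\<close>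

lemma h_deriv_p:
  assumes "(x, y) \<in> P"
  shows "h_deriv E \<alpha> \<beta> p ((x, y) - p) \<le> 0"
    and "h_deriv E \<alpha> \<beta> p ((x, y) - p) = 0 \<longleftrightarrow> (x, y) \<in> F"
proof -
  have x: "x \<in> std_simplex" and y: "y \<in> D'_set E s" using assms by (auto simp: P_set_def)
  let ?Y = "{e. e \<in> co_edges E \<and> yp $ e = 1}"
  have eq: "h_deriv E \<alpha> \<beta> p ((x, y) - p)
    = (\<Sum>i\<in>UNIV. x $ i * (gx i - gC)) + co_form E (y - yp) xC - \<beta> * (\<Sum>e\<in>?Y. 1 - y $ e)"
  proof -
    have "(\<Sum>i\<in>UNIV. (x - xC) $ i * gx i) = (\<Sum>i\<in>UNIV. x $ i * gx i) - gC"
      using sum_xC_gx by (simp add: left_diff_distrib sum_subtractf)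
    also have "gC = (\<Sum>i\<in>UNIV. x $ i * gC)"
      using x by (simp add: sum_distrib_right[symmetric] std_simplex_def)
    also have "(\<Sum>i\<in>UNIV. x $ i * gx i) - \<dots> = (\<Sum>i\<in>UNIV. x $ i * (gx i - gC))"
      by (simp add: right_diff_distrib sum_subtractf)
    finally show ?thesis
      unfolding edge_form_gx[symmetric] by (simp add: h_deriv_def inner_yp)
  qed
  have gx_le: "x $ i * (gx i - gC) \<le> - (\<alpha> / m) * (if i \<in> C then 0 else x $ i)" for i
  proof (cases "i \<in> C")
    case True
    then show ?thesis by (simp add: gx_in_C)
  next
    case False
    then have "x $ i * (gx i - gC) \<le> x $ i * (- (\<alpha> / m))"
      using gx_not_in_C[OF False] x by (intro mult_left_mono) (auto simp: std_simplex_def)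
    then show ?thesis using False by (simp add: mult.commute)
  qed
  have nonneg: "0 \<le> (if i \<in> C then 0 else x $ i)" for i using x by (simp add: std_simplex_def)
  have nonneg_Y: "0 \<le> 1 - y $ e" if "e \<in> ?Y" for e using y that by (simp add: D'_set_def)
  have "(\<Sum>i\<in>UNIV. x $ i * (gx i - gC)) \<le> (\<Sum>i\<in>UNIV. - (\<alpha> / m) * (if i \<in> C then 0 else x $ i))"
    by (intro sum_mono gx_le)
  then have le: "h_deriv E \<alpha> \<beta> p ((x, y) - p)
     \<le> - (\<alpha> / m) * (\<Sum>i\<in>UNIV. if i \<in> C then 0 else x $ i) - \<beta> * (\<Sum>e\<in>?Y. 1 - y $ e)"
    using co_form_le[OF y] unfolding eq sum_distrib_left[symmetric] by linarith
  have X: "0 \<le> (\<alpha> / m) * (\<Sum>i\<in>UNIV. if i \<in> C then 0 else x $ i)"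
    using alpha m_pos nonneg by (intro mult_nonneg_nonneg sum_nonneg) auto
  have Y: "0 \<le> \<beta> * (\<Sum>e\<in>?Y. 1 - y $ e)"
    using beta nonneg_Y by (intro mult_nonneg_nonneg sum_nonneg) auto
  show "h_deriv E \<alpha> \<beta> p ((x, y) - p) \<le> 0" using le X Y by simp
  show "h_deriv E \<alpha> \<beta> p ((x, y) - p) = 0 \<longleftrightarrow> (x, y) \<in> F"
  proof
    assume "h_deriv E \<alpha> \<beta> p ((x, y) - p) = 0"
    then have "(\<alpha> / m) * (\<Sum>i\<in>UNIV. if i \<in> C then 0 else x $ i) = 0" "\<beta> * (\<Sum>e\<in>?Y. 1 - y $ e) = 0"
      using le X Y by linarith+
    then have zero: "(\<Sum>i\<in>UNIV. if i \<in> C then 0 else x $ i) = 0" "(\<Sum>e\<in>?Y. 1 - y $ e) = 0"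
      using alpha beta m_pos by auto
    have "(if i \<in> C then 0 else x $ i) = 0" for i
      using zero(1) nonneg by (subst (asm) sum_nonneg_eq_0_iff) auto
    then have supp: "x $ i = 0" if "i \<notin> C" for i using that by metis
    have Y1: "y $ e = 1" if "e \<in> ?Y" for e
      using zero(2) nonneg_Y that by (subst (asm) sum_nonneg_eq_0_iff) auto
    \<comment> \<open>The added edges already exhaust the budget \<open>s\<close>, so
      \<open>y\<close> has nothing left for other non-edges.\<close>
    have "(\<Sum>e\<in>co_edges E. y $ e - yp $ e) \<le> 0"
      using y sum_yp by (simp add: sum_subtractf D'_set_def)
    moreover have nonneg_diff: "0 \<le> y $ e - yp $ e" if "e \<in> co_edges E" for e
      using yp_binary[OF that] Y1[of e] y that by (auto simp: D'_set_def)
    ultimately have "(\<Sum>e\<in>co_edges E. y $ e - yp $ e) = 0"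
      by (intro antisym sum_nonneg)
    then have "y $ e = yp $ e" if "e \<in> co_edges E" for e
      using nonneg_diff that by (subst (asm) sum_nonneg_eq_0_iff) auto
    moreover have "y $ e = yp $ e" if "e \<notin> co_edges E" for e
      using y yp_mem that by (simp add: D'_set_def)
    ultimately have "y = yp" by (metis vec_eq_iff)
    then show "(x, y) \<in> F" using supp x by (simp add: F_def)
  next
    assume "(x, y) \<in> F"
    then have supp: "\<And>i. i \<notin> C \<Longrightarrow> x $ i = 0" and "y = yp" by (auto simp: F_def)
    then have "x $ i * (gx i - gC) = 0" for i by (cases "i \<in> C") (auto simp: gx_in_C)
    then have "(\<Sum>i\<in>UNIV. x $ i * (gx i - gC)) = 0" by (intro sum.neutral) auto
    moreover have "co_form E (y - yp) xC = 0" "(\<Sum>e\<in>?Y. 1 - y $ e) = 0"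
      using \<open>y = yp\<close> by (auto simp: co_form_def co_matrix_def cong: if_cong)
    ultimately show "h_deriv E \<alpha> \<beta> p ((x, y) - p) = 0"
      unfolding eq by simp
  qed
qed

section \<open>The face \<open>F\<close> and the objective on it\<close>

lemma F_subset_P: "F \<subseteq> P"
  using yp_mem by (auto simp: F_def P_set_def)

lemma F_eq: "F = {q \<in> P. h_grad E \<alpha> \<beta> p \<bullet> (q - p) = 0}"
  using h_deriv_p(2) F_subset_P by (auto simp: inner_commute[of "h_grad E \<alpha> \<beta> p"] inner_h_grad simp del: diff_Pair)

lemma p_mem_F: "p \<in> F"
  using char_vec_mem_simplex[OF C_nonempty] by (auto simp: F_def char_vec_nth)

text \<open>The radius is the value of \<open>xC\<close> on \<open>C\<close>; this later turns
  closeness to \<open>p\<close> into full support.\<close>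

lemma pos_near_xC:
  assumes "dist x xC < 1 / m" "i \<in> C"
  shows "0 < x $ i"
proof -
  have "\<bar>(x - xC) $ i\<bar> < 1 / m"
    using component_le_norm_cart[of "x - xC" i] assms(1) by (simp add: dist_norm)
  then show ?thesis using assms(2) by (simp add: char_vec_nth abs_less_iff)
qed

text \<open>Dropping the sign constraints leaves an affine set \<open>?H\<close> containing the
  hull; within \<open>1 / m\<close> of \<open>p\<close> those constraints hold again.\<close>

lemma p_rel_interior_F: "p \<in> rel_interior F"
proof -
  let ?H = "{(x, y). (\<Sum>i\<in>UNIV. x $ i) = 1 \<and> (\<forall>i. i \<notin> C \<longrightarrow> x $ i = 0) \<and> y = yp}"
  have "affine ?H"
    unfolding affine_def
    by (auto simp: sum.distrib simp flip: scaleR_sum_right scaleR_left_distrib)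
  moreover have "F \<subseteq> ?H" by (auto simp: F_def std_simplex_def)
  ultimately have hull: "affine hull F \<subseteq> ?H" by (intro hull_minimal)
  have "(x, y) \<in> F" if "(x, y) \<in> ball p (1 / m)" "(x, y) \<in> ?H" for x y
  proof -
    have "dist x xC < 1 / m"
      using that(1) dist_fst_le[of "(x, y)" p] by (simp add: dist_commute)
    then have "0 \<le> x $ i" for i using pos_near_xC[of x i] that(2) by (cases "i \<in> C") auto
    then show ?thesis using that(2) by (simp add: F_def std_simplex_def)
  qed
  then have "ball p (1 / m) \<inter> affine hull F \<subseteq> F" using hull by fast
  then show ?thesis
    unfolding mem_rel_interior_ball using p_mem_F m_pos by (intro conjI exI[of _ "1 / m"]) auto
qed

text \<open>On a clique the form is the square of the coordinate sum without its diagonal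
  terms.\<close>

lemma edge_form_on_F:
  assumes "(x, yp) \<in> F"
  shows "edge_form E yp x x = 1 - x \<bullet> x"
proof -
  have x: "x \<in> std_simplex" "\<And>i. i \<notin> C \<Longrightarrow> x $ i = 0" using assms by (auto simp: F_def)
  have "edge_form E yp x x = (\<Sum>i\<in>UNIV. \<Sum>j\<in>UNIV. x $ i * x $ j - (if j = i then x $ i * x $ i else 0))"
    unfolding edge_form_yp
  proof (intro sum.cong refl)
    fix i j
    show "A i j * (x $ i * x $ j) = x $ i * x $ j - (if j = i then x $ i * x $ i else 0)"
      using clique[of i j] A_diag[of i] x(2)[of i] x(2)[of j] by (cases "i \<in> C"; cases "j \<in> C"; cases "i = j") auto
  qed
  also have "\<dots> = (\<Sum>i\<in>UNIV. x $ i) * (\<Sum>i\<in>UNIV. x $ i) - x \<bullet> x"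
    by (simp add: sum_subtractf sum_product inner_vec_def)
  finally show ?thesis using x(1) by (simp add: std_simplex_def)
qed

text \<open>All \<open>x\<close> parts in \<open>F\<close> have the same product
  \<open>1 / m\<close> with \<open>xC\<close>, so the squared distance to \<open>p\<close> is the
  difference of squared norms, and on \<open>F\<close> only the squared norm varies in
  \<open>h\<close>.\<close>

lemma h_on_F:
  assumes "q \<in> F"
  shows "h q = h p - (1 - \<alpha> / 2) * (dist q p)\<^sup>2"
proof -
  obtain x where q: "q = (x, yp)" and x: "x \<in> std_simplex" "\<And>i. i \<notin> C \<Longrightarrow> x $ i = 0"
    using assms by (auto simp: F_def)
  have inner: "u \<bullet> xC = 1 / m" if "(u, yp) \<in> F" for u
  proof -
    have "(\<Sum>i\<in>C. u $ i) = (\<Sum>i\<in>UNIV. u $ i)"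
      using that by (intro sum.mono_neutral_left) (auto simp: F_def)
    then have "(\<Sum>i\<in>UNIV. xC $ i * u $ i) = 1 / m"
      unfolding sum_char_vec using that by (simp add: F_def std_simplex_def)
    then show ?thesis by (simp add: inner_vec_def mult.commute)
  qed
  have h: "h (u, yp) = 1 - (1 - \<alpha> / 2) * (u \<bullet> u) + \<beta> / 2 * (yp \<bullet> yp)" if "(u, yp) \<in> F" for u
    by (simp add: h_obj_eq edge_form_on_F[OF that] algebra_simps)
  have "(dist q p)\<^sup>2 = (x - xC) \<bullet> (x - xC)"
    by (simp add: q dist_Pair_Pair dist_norm power2_norm_eq_inner)
  also have "\<dots> = x \<bullet> x - xC \<bullet> xC"
    using inner[of x] inner[OF p_mem_F] assms q by (simp add: inner_diff_left inner_diff_right inner_commute[of xC x])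
  finally have dist: "(dist q p)\<^sup>2 = x \<bullet> x - xC \<bullet> xC" .
  have "h q = 1 - (1 - \<alpha> / 2) * (x \<bullet> x) + \<beta> / 2 * (yp \<bullet> yp)" using h[of x] assms q by simp
  then show ?thesis unfolding h[OF p_mem_F] dist by (simp add: algebra_simps)
qed

sublocale face: nondegenerate_maximizer h "h_grad E \<alpha> \<beta>" P F p "1 - \<alpha> / 2"
proof
  show "h_grad E \<alpha> \<beta> p \<bullet> (q - p) \<le> 0" if "q \<in> P" for q
    using h_deriv_p(1)[of "fst q" "snd q"] that
    by (simp add: inner_commute[of "h_grad E \<alpha> \<beta> p"] inner_h_grad del: diff_Pair)
qed (use polytope_P_set GDERIV_h_obj isCont_h_grad F_eq p_rel_interior_F h_on_F alpha in auto)

end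

theorem proposition4p3:
  fixes E :: "'n::finite set set" and s :: nat and \<alpha> \<beta> c :: real
    and C :: "'n set" and yp :: "real ^ ('n set)"
  assumes "simple_graph E"
    and "s \<le> card (co_edges E)"
    and "0 < \<alpha>" and "\<alpha> < 2" and "0 < \<beta>"
    and "C \<noteq> {}"
    and "(char_vec C, yp) \<in> M_set E s \<alpha> \<beta>"
    and "0 < c"
  shows "\<exists>U. open U \<and> (char_vec C, yp) \<in> U \<and>
    (\<forall>z d a. fdfw_sequence (h_obj E \<alpha> \<beta>) (P_set E s) z d a
       \<and> stepsize_S1 (h_obj E \<alpha> \<beta>) (P_set E s) c z d a
       \<and> (\<exists>k. z k \<in> U) \<longrightarrow>
       (let kbar = (LEAST k. z k \<in> U) in
         (incseq (\<lambda>k. h_obj E \<alpha> \<beta> (z k)) \<longrightarrow>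
            (\<forall>k. int k \<ge> int kbar + aff_dim (minimal_face (P_set E s) (z kbar)) \<longrightarrow>
               vec_supp (fst (z k)) = C \<and> snd (z k) = yp))
         \<and> (incseq (\<lambda>k. h_obj E \<alpha> \<beta> (z k))
              \<and> (\<exists>\<rho>>0. stepsize_S2 (h_obj E \<alpha> \<beta>) (P_set E s) c \<rho> z d a) \<longrightarrow>
            z \<longlonglongrightarrow> (char_vec C, yp))))"
proof -
  interpret strict_local_maximizer E s \<alpha> \<beta> C yp
    by unfold_locales (use assms in auto)
  \<comment> \<open>Membership in \<open>F\<close> gives support inside \<open>C\<close>; the radius
    \<open>1 / m\<close> makes it all of \<open>C\<close>.\<close>
  obtain U where U: "open U" "p \<in> U"
    and ident: "\<And>z d a kbar k. fdfw_sequence h P z d a \<Longrightarrow> stepsize_S1 h P c z d a \<Longrightarrow> incseq (\<lambda>k. h (z k))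
      \<Longrightarrow> z kbar \<in> U \<Longrightarrow> int kbar + aff_dim (minimal_face P (z kbar)) \<le> int k
      \<Longrightarrow> z k \<in> F \<and> dist (z k) p < 1 / m"
    and conv: "\<And>z d a kbar \<rho>. fdfw_sequence h P z d a \<Longrightarrow> stepsize_S1 h P c z d a \<Longrightarrow> incseq (\<lambda>k. h (z k))
      \<Longrightarrow> z kbar \<in> U \<Longrightarrow> 0 < \<rho> \<Longrightarrow> stepsize_S2 h P c \<rho> z d a \<Longrightarrow> z \<longlonglongrightarrow> p"
    using face.fdfw_local_identification[OF \<open>0 < c\<close>, of "1 / m"] m_pos by auto
  have supp: "vec_supp (fst q) = C \<and> snd q = yp" if "q \<in> F" "dist q p < 1 / m" for q
  proof -
    have "dist (fst q) xC < 1 / m" using that(2) dist_fst_le[of q p] by simp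
    then show ?thesis using that(1) pos_near_xC[of "fst q"] by (force simp: F_def vec_supp_def)
  qed
  show ?thesis
  proof (rule exI[of _ U], intro conjI allI impI U)
    fix z d a
    assume z: "fdfw_sequence h P z d a \<and> stepsize_S1 h P c z d a \<and> (\<exists>k. z k \<in> U)"
    define kbar where "kbar = (LEAST k. z k \<in> U)"
    \<comment> \<open>The identification holds from any index in \<open>U\<close>, so of the first
      entry time only its membership matters.\<close>
    have "z kbar \<in> U" using z unfolding kbar_def by (auto intro: LeastI_ex)
    then show "let kbar = (LEAST k. z k \<in> U) in
         (incseq (\<lambda>k. h (z k)) \<longrightarrow>
            (\<forall>k. int k \<ge> int kbar + aff_dim (minimal_face P (z kbar)) \<longrightarrow>
               vec_supp (fst (z k)) = C \<and> snd (z k) = yp))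
         \<and> (incseq (\<lambda>k. h (z k)) \<and> (\<exists>\<rho>>0. stepsize_S2 h P c \<rho> z d a) \<longrightarrow> z \<longlonglongrightarrow> p)"
      unfolding Let_def kbar_def[symmetric] using z ident supp conv by blast
  qed
qed

end
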